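(* Let $k\ge1$, let $\mathsf{F}$ be a field, and let $\Lambda$ be a row-finite $k$-graph without sources. Suppose $(\mu,\nu)$ is a generalized cycle in $\Lambda$. If $\mathbb{Z}^k$ acts freely on the talented monoid $T_\Lambda$, then the Kumjian--Pask algebra $\mathrm{KP}_{\mathsf F}(\Lambda)$ is not ultramatricial.
   Context: $\mathbb{N}=\{0,1,2,\dots\}$; $\mathbb{Z}^k$ has the coordinatewise order, $\vee$ denotes coordinatewise maximum, $\mathbf{e}_i$ is the $i$-th unit vector. A $k$-graph is a countable small category $\Lambda$ with a functor $d:\Lambda\to\mathbb{N}^k$ (degree) such that whenever $d(\lambda)=\mathbf{n}+\mathbf{m}$ with $\mathbf{n},\mathbf{m}\in\mathbb{N}^k$ there are unique $\alpha,\beta\in\Lambda$ with $d(\alpha)=\mathbf{n}$, $d(\beta)=\mathbf{m}$, $\lambda=\alpha\beta$. The codomain and domain of a morphism (path) $\lambda$ are $r(\lambda)$ and $s(\lambda)$; $\lambda\mu$ is defined when $s(\lambda)=r(\mu)$. $\Lambda^{\mathbf{n}}=d^{-1}(\mathbf{n})$; elements of $\Lambda^0$ are identified with objects (vertices). $v\Lambda=\{\lambda: r(\lambda)=v\}$, $v\Lambda^{\mathbf{n}}=v\Lambda\cap\Lambda^{\mathbf{n}}$. $\Lambda$ is row-finite without sources if $0<|v\Lambda^{\mathbf{n}}|<\infty$ for all $v,\mathbf{n}$. For $0\le\mathbf{n}\le\mathbf{m}\le d(\lambda)$, $\lambda(\mathbf{n},\mathbf{m})$ is the unique path of degree $\mathbf{m}-\mathbf{n}$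 with $\lambda=\alpha\lambda(\mathbf{n},\mathbf{m})\beta$, $d(\alpha)=\mathbf{n}$, $d(\beta)=d(\lambda)-\mathbf{m}$. For paths $\lambda,\mu$, $\mathrm{MCE}(\lambda,\mu)$ is the set of paths $\tau$ with $d(\tau)=d(\lambda)\vee d(\mu)$, $\tau(0,d(\lambda))=\lambda$ and $\tau(0,d(\mu))=\mu$. A generalized cycle is a pair $(\mu,\nu)$ of distinct paths with $s(\mu)=s(\nu)$, $r(\mu)=r(\nu)$ and $\mathrm{MCE}(\mu\tau,\nu)\ne\emptyset$ for every $\tau\in s(\mu)\Lambda$. The talented monoid $T_\Lambda$ is the commutative monoid generated by symbols $v(\mathbf{n})$ ($v\in\Lambda^0$, $\mathbf{n}\in\mathbb{Z}^k$) subject to $v(\mathbf{n})=\sum_{\alpha\in v\Lambda^{\mathbf{e}_i}}s(\alpha)(\mathbf{n}+\mathbf{e}_i)$ for all $v,\mathbf{n}$ and $1\le i\le k$. $\mathbb{Z}^k$ acts by ${}^{\mathbf{q}}v(\mathbf{n})=v(\mathbf{n}+\mathbf{q})$. The action is free if ${}^{\mathbf{n}}a\ne a$ for all $0\neq a\in T_\Lambda$ and $0\ne\mathbf{n}\in\mathbb{Z}^k$. $\mathrm{KP}_{\mathsf F}(\Lambda)$ is the universal associative $\mathsf{F}$-algebra generated by $p_v$ ($v\in\Lambda^0$), $s_\lambda,s_{\lambda^*}$ ($\lambda\in\Lambda\setminus\Lambda^0$) with relations: (KP1) $p_up_v=\delta_{u,v}p_u$; (KP2) $s_\lambda s_\mu=s_{\lambda\mu}$,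 $s_{\mu^*}s_{\lambda^*}=s_{(\lambda\mu)^*}$ when $s(\lambda)=r(\mu)$, $p_{r(\lambda)}s_\lambda=s_\lambda=s_\lambda p_{s(\lambda)}$, $p_{s(\lambda)}s_{\lambda^*}=s_{\lambda^*}=s_{\lambda^*}p_{r(\lambda)}$; (KP3) $s_{\lambda^*}s_\mu=\delta_{\lambda,\mu}p_{s(\lambda)}$ if $d(\lambda)=d(\mu)$; (KP4) $p_v=\sum_{\lambda\in v\Lambda^{\mathbf{n}}}s_\lambda s_{\lambda^*}$ for all $v$, $\mathbf{n}\ne0$. An $\mathsf{F}$-algebra is matricial if it is isomorphic to a finite direct sum of full matrix algebras $\mathbb{M}_n(\mathsf{F})$, and ultramatricial if it is isomorphic to a direct limit of a countable sequence of matricial $\mathsf{F}$-algebras. *)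

theory Defs
  imports
    "HOL-Library.Function_Algebras"
    "HOL-Library.Countable_Set"
    "HOL-Library.Multiset"
    "HOL-Library.Poly_Mapping"
    "HOL-Algebra.QuotRing"
    "HOL-Algebra.Module"
    "Jordan_Normal_Form.Matrix"
begin

section \<open>Higher-rank graphs\<close>

text \<open>The rank is the number of elements of the (nonempty) finite index type
  \<^typ>\<open>'k::finite\<close>; degrees are functions \<^typ>\<open>'k \<Rightarrow> nat\<close> with the pointwise order,
  sum, truncated difference and \<^const>\<open>sup\<close>. Composition follows the convention of the
  subject: \<open>compose \<Lambda> \<alpha> \<beta>\<close> is meaningful when the domain (source) of \<open>\<alpha>\<close> is the codomain (range)
  of \<open>\<beta>\<close>. In a \<open>k\<close>-graph the
  paths of degree \<open>0\<close> are exactly the identities and thus correspond to the vertices. Outside the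
  sets of vertices and paths all operations are unspecified.\<close>

record ('v, 'e, 'k) kgraph =
  verts :: "'v set"
  paths :: "'e set"
  rng :: "'e \<Rightarrow> 'v"
  src :: "'e \<Rightarrow> 'v"
  ident :: "'v \<Rightarrow> 'e"
  compose :: "'e \<Rightarrow> 'e \<Rightarrow> 'e"
  deg :: "'e \<Rightarrow> 'k \<Rightarrow> nat"

locale small_category =
  fixes \<Lambda> :: "('v, 'e, 'k) kgraph"
  assumes rng_closed: "\<alpha> \<in> paths \<Lambda> \<Longrightarrow> rng \<Lambda> \<alpha> \<in> verts \<Lambda>"
    and src_closed: "\<alpha> \<in> paths \<Lambda> \<Longrightarrow> src \<Lambda> \<alpha> \<in> verts \<Lambda>"
    and ident_closed: "v \<in> verts \<Lambda> \<Longrightarrow> ident \<Lambda> v \<in> paths \<Lambda>"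
    and rng_ident: "v \<in> verts \<Lambda> \<Longrightarrow> rng \<Lambda> (ident \<Lambda> v) = v"
    and src_ident: "v \<in> verts \<Lambda> \<Longrightarrow> src \<Lambda> (ident \<Lambda> v) = v"
    and compose_closed:
      "\<lbrakk>\<alpha> \<in> paths \<Lambda>; \<beta> \<in> paths \<Lambda>; src \<Lambda> \<alpha> = rng \<Lambda> \<beta>\<rbrakk> \<Longrightarrow> compose \<Lambda> \<alpha> \<beta> \<in> paths \<Lambda>"
    and rng_compose:
      "\<lbrakk>\<alpha> \<in> paths \<Lambda>; \<beta> \<in> paths \<Lambda>; src \<Lambda> \<alpha> = rng \<Lambda> \<beta>\<rbrakk> \<Longrightarrow> rng \<Lambda> (compose \<Lambda> \<alpha> \<beta>) = rng \<Lambda> \<alpha>"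
    and src_compose:
      "\<lbrakk>\<alpha> \<in> paths \<Lambda>; \<beta> \<in> paths \<Lambda>; src \<Lambda> \<alpha> = rng \<Lambda> \<beta>\<rbrakk> \<Longrightarrow> src \<Lambda> (compose \<Lambda> \<alpha> \<beta>) = src \<Lambda> \<beta>"
    and compose_assoc:
      "\<lbrakk>\<alpha> \<in> paths \<Lambda>; \<beta> \<in> paths \<Lambda>; \<gamma> \<in> paths \<Lambda>; src \<Lambda> \<alpha> = rng \<Lambda> \<beta>; src \<Lambda> \<beta> = rng \<Lambda> \<gamma>\<rbrakk>
        \<Longrightarrow> compose \<Lambda> (compose \<Lambda> \<alpha> \<beta>) \<gamma> = compose \<Lambda> \<alpha> (compose \<Lambda> \<beta> \<gamma>)"
    and ident_left: "\<alpha> \<in> paths \<Lambda> \<Longrightarrow> compose \<Lambda> (ident \<Lambda> (rng \<Lambda> \<alpha>)) \<alpha> = \<alpha>"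
    and ident_right: "\<alpha> \<in> paths \<Lambda> \<Longrightarrow> compose \<Lambda> \<alpha> (ident \<Lambda> (src \<Lambda> \<alpha>)) = \<alpha>"

locale k_graph = small_category \<Lambda> for \<Lambda> :: "('v, 'e, 'k::finite) kgraph" +
  assumes countable_verts: "countable (verts \<Lambda>)"
    and countable_paths: "countable (paths \<Lambda>)"
    and deg_ident: "v \<in> verts \<Lambda> \<Longrightarrow> deg \<Lambda> (ident \<Lambda> v) = 0"
    and deg_compose:
      "\<lbrakk>\<alpha> \<in> paths \<Lambda>; \<beta> \<in> paths \<Lambda>; src \<Lambda> \<alpha> = rng \<Lambda> \<beta>\<rbrakk>
        \<Longrightarrow> deg \<Lambda> (compose \<Lambda> \<alpha> \<beta>) = deg \<Lambda> \<alpha> + deg \<Lambda> \<beta>"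
    and unique_factorization:
      "\<lbrakk>\<gamma> \<in> paths \<Lambda>; deg \<Lambda> \<gamma> = n + m\<rbrakk> \<Longrightarrow>
        \<exists>!(\<alpha>, \<beta>). \<alpha> \<in> paths \<Lambda> \<and> \<beta> \<in> paths \<Lambda> \<and> deg \<Lambda> \<alpha> = n \<and> deg \<Lambda> \<beta> = m \<and>
          src \<Lambda> \<alpha> = rng \<Lambda> \<beta> \<and> \<gamma> = compose \<Lambda> \<alpha> \<beta>"

definition paths_from :: "('v, 'e, 'k) kgraph \<Rightarrow> 'v \<Rightarrow> ('k \<Rightarrow> nat) \<Rightarrow> 'e set" where
  "paths_from \<Lambda> v n = {\<alpha> \<in> paths \<Lambda>. rng \<Lambda> \<alpha> = v \<and> deg \<Lambda> \<alpha> = n}"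

definition row_finite_no_sources :: "('v, 'e, 'k) kgraph \<Rightarrow> bool" where
  "row_finite_no_sources \<Lambda> \<longleftrightarrow>
    (\<forall>v \<in> verts \<Lambda>. \<forall>n. finite (paths_from \<Lambda> v n) \<and> paths_from \<Lambda> v n \<noteq> {})"

text \<open>The path \<open>\<gamma>(n,m)\<close>, meaningful for \<open>n \<le> m \<le> deg \<Lambda> \<gamma>\<close>.\<close>

definition segment :: "('v, 'e, 'k) kgraph \<Rightarrow> 'e \<Rightarrow> ('k \<Rightarrow> nat) \<Rightarrow> ('k \<Rightarrow> nat) \<Rightarrow> 'e" where
  "segment \<Lambda> \<gamma> n m = (THE \<tau>. \<tau> \<in> paths \<Lambda> \<and> deg \<Lambda> \<tau> = m - n \<and>
    (\<exists>\<alpha> \<in> paths \<Lambda>. \<exists>\<beta> \<in> paths \<Lambda>. deg \<Lambda> \<alpha> = n \<and> deg \<Lambda> \<beta> = deg \<Lambda> \<gamma> - m \<and>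
      src \<Lambda> \<alpha> = rng \<Lambda> \<tau> \<and> src \<Lambda> \<tau> = rng \<Lambda> \<beta> \<and> \<gamma> = compose \<Lambda> (compose \<Lambda> \<alpha> \<tau>) \<beta>))"

definition MCE :: "('v, 'e, 'k) kgraph \<Rightarrow> 'e \<Rightarrow> 'e \<Rightarrow> 'e set" where
  "MCE \<Lambda> \<mu> \<nu> = {\<tau> \<in> paths \<Lambda>. deg \<Lambda> \<tau> = sup (deg \<Lambda> \<mu>) (deg \<Lambda> \<nu>) \<and>
     segment \<Lambda> \<tau> 0 (deg \<Lambda> \<mu>) = \<mu> \<and> segment \<Lambda> \<tau> 0 (deg \<Lambda> \<nu>) = \<nu>}"

definition generalized_cycle :: "('v, 'e, 'k) kgraph \<Rightarrow> 'e \<Rightarrow> 'e \<Rightarrow> bool" where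
  "generalized_cycle \<Lambda> \<mu> \<nu> \<longleftrightarrow>
    \<mu> \<in> paths \<Lambda> \<and> \<nu> \<in> paths \<Lambda> \<and> \<mu> \<noteq> \<nu> \<and> src \<Lambda> \<mu> = src \<Lambda> \<nu> \<and> rng \<Lambda> \<mu> = rng \<Lambda> \<nu> \<and>
    (\<forall>\<tau> \<in> paths \<Lambda>. rng \<Lambda> \<tau> = src \<Lambda> \<mu> \<longrightarrow> MCE \<Lambda> (compose \<Lambda> \<mu> \<tau>) \<nu> \<noteq> {})"


section \<open>The talented monoid\<close>

definition basis_vec :: "'k \<Rightarrow> 'k \<Rightarrow> 'a::zero_neq_one" where
  "basis_vec i = (\<lambda>j. if j = i then 1 else 0)"

text \<open>The free commutative monoid on the symbols \<open>v(n)\<close> consists of the finite multisets of pairs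
  \<open>(v, n)\<close>; the relation below is the monoid congruence on it generated by the defining relations.\<close>

definition talented_free :: "('v, 'e, 'k) kgraph \<Rightarrow> ('v \<times> ('k \<Rightarrow> int)) multiset set" where
  "talented_free \<Lambda> = {x. set_mset x \<subseteq> verts \<Lambda> \<times> UNIV}"

inductive_set talented_cong ::
    "('v, 'e, 'k) kgraph \<Rightarrow> (('v \<times> ('k \<Rightarrow> int)) multiset \<times> ('v \<times> ('k \<Rightarrow> int)) multiset) set"
  for \<Lambda> where
  relation: "v \<in> verts \<Lambda> \<Longrightarrow>
    ({# (v, n) #},
     image_mset (\<lambda>\<alpha>. (src \<Lambda> \<alpha>, n + basis_vec i)) (mset_set (paths_from \<Lambda> v (basis_vec i))))
      \<in> talented_cong \<Lambda>"
| refl: "x \<in> talented_free \<Lambda> \<Longrightarrow> (x, x) \<in> talented_cong \<Lambda>"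
| sym: "(x, y) \<in> talented_cong \<Lambda> \<Longrightarrow> (y, x) \<in> talented_cong \<Lambda>"
| trans: "\<lbrakk>(x, y) \<in> talented_cong \<Lambda>; (y, z) \<in> talented_cong \<Lambda>\<rbrakk> \<Longrightarrow> (x, z) \<in> talented_cong \<Lambda>"
| add: "\<lbrakk>(x, y) \<in> talented_cong \<Lambda>; z \<in> talented_free \<Lambda>\<rbrakk>
    \<Longrightarrow> (x + z, y + z) \<in> talented_cong \<Lambda>"

text \<open>The monoid is additive; \<open>mult\<close> and \<open>one\<close> of the record are its sum and its zero.\<close>

definition talented_monoid :: "('v, 'e, 'k) kgraph \<Rightarrow> ('v \<times> ('k \<Rightarrow> int)) multiset set monoid" where
  "talented_monoid \<Lambda> = \<lparr>
    carrier = talented_free \<Lambda> // talented_cong \<Lambda>,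
    monoid.mult = (\<lambda>X Y. \<Union>x\<in>X. \<Union>y\<in>Y. talented_cong \<Lambda> `` {x + y}),
    one = talented_cong \<Lambda> `` {{#}}\<rparr>"

definition talented_shift ::
    "('k \<Rightarrow> int) \<Rightarrow> ('v \<times> ('k \<Rightarrow> int)) multiset set \<Rightarrow> ('v \<times> ('k \<Rightarrow> int)) multiset set" where
  "talented_shift q X = image_mset (\<lambda>(v, n). (v, n + q)) ` X"

definition talented_action_free :: "('v, 'e, 'k) kgraph \<Rightarrow> bool" where
  "talented_action_free \<Lambda> \<longleftrightarrow>
    (\<forall>a \<in> carrier (talented_monoid \<Lambda>). a \<noteq> \<one>\<^bsub>talented_monoid \<Lambda>\<^esub> \<longrightarrow>
      (\<forall>n. n \<noteq> 0 \<longrightarrow> talented_shift n a \<noteq> a))"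


section \<open>Algebras over a field, not necessarily unital\<close>

text \<open>We use the records of \<^theory>\<open>HOL-Algebra.Module\<close> and never refer to their component
  \<open>one\<close>. Homomorphisms need not respect units, should there be any.\<close>

locale nonunital_algebra = A?: abelian_group A for A :: "('f::field, 'a) module" (structure) +
  assumes mult_closed: "\<lbrakk>x \<in> carrier A; y \<in> carrier A\<rbrakk> \<Longrightarrow> x \<otimes> y \<in> carrier A"
    and mult_assoc: "\<lbrakk>x \<in> carrier A; y \<in> carrier A; z \<in> carrier A\<rbrakk>
      \<Longrightarrow> (x \<otimes> y) \<otimes> z = x \<otimes> (y \<otimes> z)"
    and distrib_left: "\<lbrakk>x \<in> carrier A; y \<in> carrier A; z \<in> carrier A\<rbrakk>
      \<Longrightarrow> x \<otimes> (y \<oplus> z) = x \<otimes> y \<oplus> x \<otimes> z"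
    and distrib_right: "\<lbrakk>x \<in> carrier A; y \<in> carrier A; z \<in> carrier A\<rbrakk>
      \<Longrightarrow> (x \<oplus> y) \<otimes> z = x \<otimes> z \<oplus> y \<otimes> z"
    and smult_closed: "x \<in> carrier A \<Longrightarrow> c \<odot> x \<in> carrier A"
    and smult_add: "\<lbrakk>x \<in> carrier A; y \<in> carrier A\<rbrakk> \<Longrightarrow> c \<odot> (x \<oplus> y) = c \<odot> x \<oplus> c \<odot> y"
    and add_smult: "x \<in> carrier A \<Longrightarrow> (c + d) \<odot> x = c \<odot> x \<oplus> d \<odot> x"
    and smult_smult: "x \<in> carrier A \<Longrightarrow> (c * d) \<odot> x = c \<odot> (d \<odot> x)"
    and one_smult: "x \<in> carrier A \<Longrightarrow> 1 \<odot> x = x"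
    and smult_mult_left: "\<lbrakk>x \<in> carrier A; y \<in> carrier A\<rbrakk> \<Longrightarrow> (c \<odot> x) \<otimes> y = c \<odot> (x \<otimes> y)"
    and smult_mult_right: "\<lbrakk>x \<in> carrier A; y \<in> carrier A\<rbrakk> \<Longrightarrow> x \<otimes> (c \<odot> y) = c \<odot> (x \<otimes> y)"

definition algebra_hom :: "('f, 'a) module \<Rightarrow> ('f, 'b) module \<Rightarrow> ('a \<Rightarrow> 'b) set" where
  "algebra_hom A B = {h \<in> carrier A \<rightarrow> carrier B.
    (\<forall>x \<in> carrier A. \<forall>y \<in> carrier A. h (x \<oplus>\<^bsub>A\<^esub> y) = h x \<oplus>\<^bsub>B\<^esub> h y \<and> h (x \<otimes>\<^bsub>A\<^esub> y) = h x \<otimes>\<^bsub>B\<^esub> h y) \<and>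
    (\<forall>c. \<forall>x \<in> carrier A. h (c \<odot>\<^bsub>A\<^esub> x) = c \<odot>\<^bsub>B\<^esub> h x)}"

definition algebra_isomorphic :: "('f, 'a) module \<Rightarrow> ('f, 'b) module \<Rightarrow> bool" where
  "algebra_isomorphic A B \<longleftrightarrow> (\<exists>h \<in> algebra_hom A B. bij_betw h (carrier A) (carrier B))"

subsection \<open>Free algebras and quotients\<close>

text \<open>With lists as the free monoid, finitely supported functions on lists with the
  convolution product of \<^theory>\<open>HOL-Library.Poly_Mapping\<close> are the noncommutative polynomials. The
  free algebra without unit consists of those in which the empty word does not occur.\<close>

instantiation list :: (type) monoid_add
begin

definition zero_list :: "'a list" where "zero_list = []"

definition plus_list :: "'a list \<Rightarrow> 'a list \<Rightarrow> 'a list" where "plus_list = (@)"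

instance
  by standard (simp_all add: zero_list_def plus_list_def)

end

definition free_algebra :: "'g set \<Rightarrow> ('f::field, 'g list \<Rightarrow>\<^sub>0 'f) module" where
  "free_algebra G = \<lparr>
    carrier = {x. Poly_Mapping.keys x \<subseteq> lists G - {[]}},
    monoid.mult = (*),
    one = undefined,
    ring.zero = 0,
    add = (+),
    smult = (\<lambda>c. Poly_Mapping.map ((*) c))\<rparr>"

inductive_set ideal_generated :: "('f, 'a) module \<Rightarrow> 'a set \<Rightarrow> 'a set"
  for A :: "('f, 'a) module" (structure) and R :: "'a set" where
  zero: "\<zero> \<in> ideal_generated A R"
| incl: "x \<in> R \<Longrightarrow> x \<in> ideal_generated A R"
| add: "\<lbrakk>x \<in> ideal_generated A R; y \<in> ideal_generated A R\<rbrakk> \<Longrightarrow> x \<oplus> y \<in> ideal_generated A R"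
| smult: "x \<in> ideal_generated A R \<Longrightarrow> c \<odot> x \<in> ideal_generated A R"
| left: "\<lbrakk>a \<in> carrier A; x \<in> ideal_generated A R\<rbrakk> \<Longrightarrow> a \<otimes> x \<in> ideal_generated A R"
| right: "\<lbrakk>a \<in> carrier A; x \<in> ideal_generated A R\<rbrakk> \<Longrightarrow> x \<otimes> a \<in> ideal_generated A R"

definition quotient_algebra :: "('f, 'a) module \<Rightarrow> 'a set \<Rightarrow> ('f, 'a set) module" where
  "quotient_algebra A I = \<lparr>
    carrier = a_rcosets\<^bsub>A\<^esub> I,
    monoid.mult = rcoset_mult A I,
    one = undefined,
    ring.zero = I,
    add = set_add A,
    smult = (\<lambda>c X. \<Union>x\<in>X. I +>\<^bsub>A\<^esub> (c \<odot>\<^bsub>A\<^esub> x))\<rparr>"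

subsection \<open>Matricial and ultramatricial algebras\<close>

definition matrix_sum :: "nat list \<Rightarrow> ('f::field, 'f mat list) module" where
  "matrix_sum ns = \<lparr>
    carrier = {Ms. list_all2 (\<lambda>M n. M \<in> carrier_mat n n) Ms ns},
    monoid.mult = map2 (*),
    one = map 1\<^sub>m ns,
    ring.zero = map (\<lambda>n. 0\<^sub>m n n) ns,
    add = map2 (+),
    smult = (\<lambda>c. map ((\<cdot>\<^sub>m) c))\<rparr>"

definition matricial :: "('f::field, 'a) module \<Rightarrow> bool" where
  "matricial A \<longleftrightarrow> nonunital_algebra A \<and>
    (\<exists>ns. (\<forall>n \<in> set ns. n \<ge> 1) \<and> algebra_isomorphic A (matrix_sum ns))"

text \<open>The direct limit of \<open>A 0 \<rightarrow> A 1 \<rightarrow> A 2 \<rightarrow> \<dots>\<close> along \<open>\<phi> n : A n \<rightarrow> A (n + 1)\<close>, as a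
  quotient of the disjoint union. Note that \<open>fold \<phi> [m..<n]\<close> is the composite map
  \<open>A m \<rightarrow> A n\<close> for \<open>m \<le> n\<close>.\<close>

definition direct_limit_rel ::
    "(nat \<Rightarrow> ('f, 'a) module) \<Rightarrow> (nat \<Rightarrow> 'a \<Rightarrow> 'a) \<Rightarrow> ((nat \<times> 'a) \<times> (nat \<times> 'a)) set" where
  "direct_limit_rel A \<phi> = {((m, x), (n, y)). x \<in> carrier (A m) \<and> y \<in> carrier (A n) \<and>
    (\<exists>l \<ge> max m n. fold \<phi> [m..<l] x = fold \<phi> [n..<l] y)}"

text \<open>Any two elements of the limit have representatives at a common stage, and the operations
  are computed there.\<close>

definition direct_limit ::
    "(nat \<Rightarrow> ('f, 'a) module) \<Rightarrow> (nat \<Rightarrow> 'a \<Rightarrow> 'a) \<Rightarrow> ('f, (nat \<times> 'a) set) module" where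
  "direct_limit A \<phi> = \<lparr>
    carrier = (SIGMA n:UNIV. carrier (A n)) // direct_limit_rel A \<phi>,
    monoid.mult = (\<lambda>X Y. \<Union>{direct_limit_rel A \<phi> `` {(n, x \<otimes>\<^bsub>A n\<^esub> y)} | n x y. (n, x) \<in> X \<and> (n, y) \<in> Y}),
    one = undefined,
    ring.zero = direct_limit_rel A \<phi> `` {(0, \<zero>\<^bsub>A 0\<^esub>)},
    add = (\<lambda>X Y. \<Union>{direct_limit_rel A \<phi> `` {(n, x \<oplus>\<^bsub>A n\<^esub> y)} | n x y. (n, x) \<in> X \<and> (n, y) \<in> Y}),
    smult = (\<lambda>c X. \<Union>{direct_limit_rel A \<phi> `` {(n, c \<odot>\<^bsub>A n\<^esub> x)} | n x. (n, x) \<in> X})\<rparr>"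

text \<open>It is no restriction that the algebras \<open>A n\<close> live on the type \<^typ>\<open>'f mat list\<close>, since every
  matricial algebra is isomorphic to some \<^term>\<open>matrix_sum ns\<close>.\<close>

definition ultramatricial :: "('f::field, 'b) module \<Rightarrow> bool" where
  "ultramatricial B \<longleftrightarrow> nonunital_algebra B \<and>
    (\<exists>(A :: nat \<Rightarrow> ('f, 'f mat list) module) \<phi>.
      (\<forall>n. matricial (A n)) \<and> (\<forall>n. \<phi> n \<in> algebra_hom (A n) (A (Suc n))) \<and>
      algebra_isomorphic B (direct_limit A \<phi>))"


section \<open>Kumjian--Pask algebras\<close>

text \<open>\<open>Vertex v\<close>, \<open>Path \<alpha>\<close> and \<open>Ghost \<alpha>\<close> are the symbols \<open>p\<^sub>v\<close>, \<open>s\<^sub>\<alpha>\<close> and \<open>s\<^sub>\<alpha>\<^sub>*\<close>.\<close>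

datatype ('v, 'e) kp_symbol = Vertex 'v | Path 'e | Ghost 'e

definition nontrivial_paths :: "('v, 'e, 'k) kgraph \<Rightarrow> 'e set" where
  "nontrivial_paths \<Lambda> = {\<alpha> \<in> paths \<Lambda>. deg \<Lambda> \<alpha> \<noteq> 0}"

definition kp_symbols :: "('v, 'e, 'k) kgraph \<Rightarrow> ('v, 'e) kp_symbol set" where
  "kp_symbols \<Lambda> = Vertex ` verts \<Lambda> \<union> Path ` nontrivial_paths \<Lambda> \<union> Ghost ` nontrivial_paths \<Lambda>"

abbreviation kp_p :: "'v \<Rightarrow> ('v, 'e) kp_symbol list \<Rightarrow>\<^sub>0 'f::field" where
  "kp_p v \<equiv> Poly_Mapping.single [Vertex v] 1"

abbreviation kp_s :: "'e \<Rightarrow> ('v, 'e) kp_symbol list \<Rightarrow>\<^sub>0 'f::field" where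
  "kp_s \<alpha> \<equiv> Poly_Mapping.single [Path \<alpha>] 1"

abbreviation kp_t :: "'e \<Rightarrow> ('v, 'e) kp_symbol list \<Rightarrow>\<^sub>0 'f::field" where
  "kp_t \<alpha> \<equiv> Poly_Mapping.single [Ghost \<alpha>] 1"

inductive_set kp_relators :: "('v, 'e, 'k) kgraph \<Rightarrow> (('v, 'e) kp_symbol list \<Rightarrow>\<^sub>0 'f::field) set"
  for \<Lambda> where
  KP1: "\<lbrakk>u \<in> verts \<Lambda>; v \<in> verts \<Lambda>\<rbrakk>
    \<Longrightarrow> kp_p u * kp_p v - (if u = v then kp_p u else 0) \<in> kp_relators \<Lambda>"
| KP2_path: "\<lbrakk>\<alpha> \<in> nontrivial_paths \<Lambda>; \<beta> \<in> nontrivial_paths \<Lambda>; src \<Lambda> \<alpha> = rng \<Lambda> \<beta>\<rbrakk>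
    \<Longrightarrow> kp_s \<alpha> * kp_s \<beta> - kp_s (compose \<Lambda> \<alpha> \<beta>) \<in> kp_relators \<Lambda>"
| KP2_ghost: "\<lbrakk>\<alpha> \<in> nontrivial_paths \<Lambda>; \<beta> \<in> nontrivial_paths \<Lambda>; src \<Lambda> \<alpha> = rng \<Lambda> \<beta>\<rbrakk>
    \<Longrightarrow> kp_t \<beta> * kp_t \<alpha> - kp_t (compose \<Lambda> \<alpha> \<beta>) \<in> kp_relators \<Lambda>"
| KP2_rng_path: "\<alpha> \<in> nontrivial_paths \<Lambda> \<Longrightarrow> kp_p (rng \<Lambda> \<alpha>) * kp_s \<alpha> - kp_s \<alpha> \<in> kp_relators \<Lambda>"
| KP2_path_src: "\<alpha> \<in> nontrivial_paths \<Lambda> \<Longrightarrow> kp_s \<alpha> * kp_p (src \<Lambda> \<alpha>) - kp_s \<alpha> \<in> kp_relators \<Lambda>"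
| KP2_src_ghost: "\<alpha> \<in> nontrivial_paths \<Lambda> \<Longrightarrow> kp_p (src \<Lambda> \<alpha>) * kp_t \<alpha> - kp_t \<alpha> \<in> kp_relators \<Lambda>"
| KP2_ghost_rng: "\<alpha> \<in> nontrivial_paths \<Lambda> \<Longrightarrow> kp_t \<alpha> * kp_p (rng \<Lambda> \<alpha>) - kp_t \<alpha> \<in> kp_relators \<Lambda>"
| KP3: "\<lbrakk>\<alpha> \<in> nontrivial_paths \<Lambda>; \<beta> \<in> nontrivial_paths \<Lambda>; deg \<Lambda> \<alpha> = deg \<Lambda> \<beta>\<rbrakk>
    \<Longrightarrow> kp_t \<alpha> * kp_s \<beta> - (if \<alpha> = \<beta> then kp_p (src \<Lambda> \<alpha>) else 0) \<in> kp_relators \<Lambda>"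
| KP4: "\<lbrakk>v \<in> verts \<Lambda>; n \<noteq> 0\<rbrakk>
    \<Longrightarrow> kp_p v - (\<Sum>\<alpha> \<in> paths_from \<Lambda> v n. kp_s \<alpha> * kp_t \<alpha>) \<in> kp_relators \<Lambda>"

definition kp_algebra ::
    "('v, 'e, 'k) kgraph \<Rightarrow> ('f::field, (('v, 'e) kp_symbol list \<Rightarrow>\<^sub>0 'f) set) module" where
  "kp_algebra \<Lambda> = quotient_algebra (free_algebra (kp_symbols \<Lambda>))
     (ideal_generated (free_algebra (kp_symbols \<Lambda>)) (kp_relators \<Lambda>))"

end

theory Submission
  imports Defs "Jordan_Normal_Form.Determinant"
begin

text \<open>In a generalized cycle every long extension of \<open>\<mu>\<close> extends \<open>\<nu>\<close>, so the range projection
  \<open>e = s\<^sub>\<mu> s\<^sub>\<mu>\<^sub>*\<close> lies below \<open>f = s\<^sub>\<nu> s\<^sub>\<nu>\<^sub>*\<close>, while \<open>x = s\<^sub>\<mu> s\<^sub>\<nu>\<^sub>*\<close> and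
  \<open>y = s\<^sub>\<nu> s\<^sub>\<mu>\<^sub>*\<close> satisfy \<open>y x = f\<close> and \<open>x y = e\<close>. In an ultramatricial algebra one-sided
  inverses in the corner of an idempotent are two-sided, because finitely many equations already
  hold at a matricial stage; hence \<open>e = f\<close>. Letting both sides act on functions of infinite paths,
  an infinite path starts with \<open>\<mu>\<close> iff it starts with \<open>\<nu>\<close>. So \<open>\<mu>\<close> and \<open>\<nu>\<close> have the same
  extensions of degree \<open>d(\<mu>) \<squnion> d(\<nu>)\<close>, and expanding \<open>v = s(\<mu>) = s(\<nu>)\<close> in the talented monoid
  gives \<open>v(d(\<mu>)) = v(d(\<nu>))\<close>. Freeness forces \<open>d(\<mu>) = d(\<nu>)\<close>, and then \<open>\<mu> = \<nu>\<close>.\<close>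

section \<open>Directly finite corners\<close>

text \<open>The cycle condition is one-sided: it puts e below f and gives nothing in the other
  direction. Finiteness of the algebra upgrades this to e = f, but an equation in an algebra given
  by generators and relations says nothing about paths until it is evaluated somewhere. Functions of
  infinite paths are chosen because there the range projections of paths become multiplication by
  indicator functions of cylinder sets, so that e = f, tested on the constant function 1, is an
  equality of two sets of infinite paths. Corners take the place of the whole algebra because with
  infinitely many vertices there is no unit. The property is phrased as "six equations imply a
  seventh", a form that passes through injective homomorphisms and direct limits. Having no sources
  matters in two places: every finite path lies on an infinite one, and v(m) is nonzero in the
  talented monoid, so that freeness applies to it.\<close>

definition corner_finite :: "('f, 'a) module \<Rightarrow> bool" where
  "corner_finite A \<longleftrightarrow> (\<forall>f \<in> carrier A. \<forall>x \<in> carrier A. \<forall>y \<in> carrier A.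
     f \<otimes>\<^bsub>A\<^esub> f = f \<longrightarrow> f \<otimes>\<^bsub>A\<^esub> x = x \<longrightarrow> x \<otimes>\<^bsub>A\<^esub> f = x \<longrightarrow>
     f \<otimes>\<^bsub>A\<^esub> y = y \<longrightarrow> y \<otimes>\<^bsub>A\<^esub> f = y \<longrightarrow> y \<otimes>\<^bsub>A\<^esub> x = f \<longrightarrow> x \<otimes>\<^bsub>A\<^esub> y = f)"

lemma corner_finiteD:
  assumes "corner_finite A" "f \<in> carrier A" "x \<in> carrier A" "y \<in> carrier A"
    and "f \<otimes>\<^bsub>A\<^esub> f = f" "f \<otimes>\<^bsub>A\<^esub> x = x" "x \<otimes>\<^bsub>A\<^esub> f = x"
    and "f \<otimes>\<^bsub>A\<^esub> y = y" "y \<otimes>\<^bsub>A\<^esub> f = y" "y \<otimes>\<^bsub>A\<^esub> x = f"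
  shows "x \<otimes>\<^bsub>A\<^esub> y = f"
  using assms unfolding corner_finite_def by blast

lemma algebra_hom_closed: "h \<in> algebra_hom A B \<Longrightarrow> x \<in> carrier A \<Longrightarrow> h x \<in> carrier B"
  by (auto simp: algebra_hom_def)

lemma algebra_hom_mult:
  "\<lbrakk>h \<in> algebra_hom A B; x \<in> carrier A; y \<in> carrier A\<rbrakk> \<Longrightarrow> h (x \<otimes>\<^bsub>A\<^esub> y) = h x \<otimes>\<^bsub>B\<^esub> h y"
  by (auto simp: algebra_hom_def)

text \<open>The premises are equations, which the homomorphism carries to \<open>B\<close>;
  injectivity brings the conclusion back. \<open>closed\<close> puts the product of \<open>x\<close>
  and \<open>y\<close> into the carrier, where injectivity is known.\<close>

lemma corner_finite_isomorphic:
  assumes iso: "algebra_isomorphic A B" and fin: "corner_finite B"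
    and closed: "\<And>x y. \<lbrakk>x \<in> carrier A; y \<in> carrier A\<rbrakk> \<Longrightarrow> x \<otimes>\<^bsub>A\<^esub> y \<in> carrier A"
  shows "corner_finite A"
proof -
  obtain h where h: "h \<in> algebra_hom A B" and inj: "inj_on h (carrier A)"
    using iso by (auto simp: algebra_isomorphic_def bij_betw_def)
  show ?thesis
    unfolding corner_finite_def
  proof (intro ballI impI)
    fix f x y
    assume *: "f \<in> carrier A" "x \<in> carrier A" "y \<in> carrier A"
      and "f \<otimes>\<^bsub>A\<^esub> f = f" "f \<otimes>\<^bsub>A\<^esub> x = x" "x \<otimes>\<^bsub>A\<^esub> f = x"
      and "f \<otimes>\<^bsub>A\<^esub> y = y" "y \<otimes>\<^bsub>A\<^esub> f = y" "y \<otimes>\<^bsub>A\<^esub> x = f"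
    then have "h x \<otimes>\<^bsub>B\<^esub> h y = h f"
      by - (rule corner_finiteD[OF fin], simp_all add: algebra_hom_closed[OF h] flip: algebra_hom_mult[OF h])
    then have "h (x \<otimes>\<^bsub>A\<^esub> y) = h f"
      using * by (simp add: algebra_hom_mult[OF h])
    then show "x \<otimes>\<^bsub>A\<^esub> y = f"
      using inj * closed by (auto dest: inj_onD)
  qed
qed

text \<open>The invertible elements \<open>y + (1 - f)\<close> and \<open>x + (1 - f)\<close> extend a pair of one-sided inverses
  in the corner of \<open>f\<close> to the whole matrix algebra.\<close>

lemma mat_corner_inverse:
  fixes f x y :: "'f::field mat"
  assumes carr: "f \<in> carrier_mat n n" "x \<in> carrier_mat n n" "y \<in> carrier_mat n n"
    and ff: "f * f = f" and fx: "f * x = x" and xf: "x * f = x"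
    and fy: "f * y = y" and yf: "y * f = y" and yx: "y * x = f"
  shows "x * y = f"
proof -
  define g where "g = 1\<^sub>m n - f"
  have g: "g \<in> carrier_mat n n"
    unfolding g_def using carr(1) by (rule minus_carrier_mat)
  have right_zero: "z * g = 0\<^sub>m n n" if "z \<in> carrier_mat n n" "z * f = z" for z
    using that carr by (simp add: g_def mult_minus_distrib_mat[of z n n _ n])
  have left_zero: "g * z = 0\<^sub>m n n" if "z \<in> carrier_mat n n" "f * z = z" for z
    using that carr by (simp add: g_def minus_mult_distrib_mat[of _ n n _ z n])
  have "g * g = g * 1\<^sub>m n - g * f"
    using carr g by (simp add: g_def mult_minus_distrib_mat[of _ n n _ n])
  then have gg: "g * g = g"
    using carr g left_zero[OF carr(1) ff] by auto
  have fg: "f + g = 1\<^sub>m n"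
    using carr by (intro eq_matI) (auto simp: g_def)
  \<comment> \<open>A product of block diagonal matrices: \<open>a * g\<close> and
    \<open>g * b\<close> vanish, so only \<open>a * b\<close> and \<open>g * g = g\<close>
    survive.\<close>
  have expand: "(a + g) * (b + g) = a * b + g"
    if "a \<in> carrier_mat n n" "b \<in> carrier_mat n n" "a * f = a" "f * b = b" for a b
  proof -
    have "(a + g) * (b + g) = (a + g) * b + (a + g) * g"
      using that g by (intro mult_add_distrib_mat) auto
    also have "(a + g) * b = a * b + g * b"
      using that g by (intro add_mult_distrib_mat) auto
    also have "(a + g) * g = a * g + g * g"
      using that g by (intro add_mult_distrib_mat) auto
    finally show ?thesis
      using that g gg right_zero left_zero by simp
  qed
  have "(y + g) * (x + g) = 1\<^sub>m n"
    using expand[OF carr(3,2) yf fx] yx fg by simp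
  \<comment> \<open>Finite dimension enters here: a one-sided inverse of a square matrix is
    two-sided.\<close>
  then have "(x + g) * (y + g) = 1\<^sub>m n"
    using carr g by (intro mat_mult_left_right_inverse[of "y + g" n "x + g"] add_carrier_mat)
  then have eq: "x * y + g = f + g"
    using expand[OF carr(2,3) xf fy] fg by simp
  show ?thesis
  proof (rule eq_matI)
    fix i j assume ij: "i < dim_row f" "j < dim_col f"
    then have "(x * y + g) $$ (i, j) = (f + g) $$ (i, j)"
      by (simp add: eq)
    then show "(x * y) $$ (i, j) = f $$ (i, j)"
      using carr g ij by simp
  qed (use carr in auto)
qed

lemma corner_finite_matrix_sum: "corner_finite (matrix_sum ns :: ('f::field, 'f mat list) module)"
  unfolding corner_finite_def
proof (intro ballI impI)
  fix f x y :: "'f mat list"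
  assume carr: "f \<in> carrier (matrix_sum ns)" "x \<in> carrier (matrix_sum ns)" "y \<in> carrier (matrix_sum ns)"
    and eqs: "f \<otimes>\<^bsub>matrix_sum ns\<^esub> f = f" "f \<otimes>\<^bsub>matrix_sum ns\<^esub> x = x" "x \<otimes>\<^bsub>matrix_sum ns\<^esub> f = x"
      "f \<otimes>\<^bsub>matrix_sum ns\<^esub> y = y" "y \<otimes>\<^bsub>matrix_sum ns\<^esub> f = y" "y \<otimes>\<^bsub>matrix_sum ns\<^esub> x = f"
  have len: "length f = length ns" "length x = length ns" "length y = length ns"
    using carr by (auto simp: matrix_sum_def dest: list_all2_lengthD)
  have comp: "a ! i * b ! i = c ! i"
    if "a \<otimes>\<^bsub>matrix_sum ns\<^esub> b = c" "i < length ns" "length a = length ns" "length b = length ns"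
    for a b c i
    using that by (auto simp: matrix_sum_def)
  show "x \<otimes>\<^bsub>matrix_sum ns\<^esub> y = f"
  proof (rule nth_equalityI)
    show "length (x \<otimes>\<^bsub>matrix_sum ns\<^esub> y) = length f"
      using len by (simp add: matrix_sum_def)
    fix i assume "i < length (x \<otimes>\<^bsub>matrix_sum ns\<^esub> y)"
    then have i: "i < length ns"
      using len by (simp add: matrix_sum_def)
    have "x ! i * y ! i = f ! i"
    proof (rule mat_corner_inverse)
      show "f ! i \<in> carrier_mat (ns ! i) (ns ! i)" "x ! i \<in> carrier_mat (ns ! i) (ns ! i)"
        "y ! i \<in> carrier_mat (ns ! i) (ns ! i)"
        using carr i len by (auto simp: matrix_sum_def dest: list_all2_nthD)
    \<comment> \<open>The remaining premises are the six equations of \<open>eqs\<close>, each read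
      in component \<open>i\<close>.\<close>
    qed (rule comp[OF _ i], fact eqs, fact len, fact len)+
    then show "(x \<otimes>\<^bsub>matrix_sum ns\<^esub> y) ! i = f ! i"
      using i len by (simp add: matrix_sum_def)
  qed
qed

section \<open>Direct limits of algebras\<close>

locale direct_system =
  fixes A :: "nat \<Rightarrow> ('f::field, 'a) module" and \<phi> :: "nat \<Rightarrow> 'a \<Rightarrow> 'a"
  assumes algebra: "\<And>n. nonunital_algebra (A n)"
    and hom: "\<And>n. \<phi> n \<in> algebra_hom (A n) (A (Suc n))"
begin

lemma fold_closed: "m \<le> n \<Longrightarrow> x \<in> carrier (A m) \<Longrightarrow> fold \<phi> [m..<n] x \<in> carrier (A n)"
  by (induction n rule: dec_induct) (auto intro: algebra_hom_closed[OF hom])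

lemma fold_mult:
  "\<lbrakk>m \<le> n; x \<in> carrier (A m); y \<in> carrier (A m)\<rbrakk> \<Longrightarrow>
    fold \<phi> [m..<n] (x \<otimes>\<^bsub>A m\<^esub> y) = fold \<phi> [m..<n] x \<otimes>\<^bsub>A n\<^esub> fold \<phi> [m..<n] y"
  by (induction n rule: dec_induct) (auto simp: algebra_hom_mult[OF hom] fold_closed)

lemma fold_fold: "m \<le> l \<Longrightarrow> l \<le> n \<Longrightarrow> fold \<phi> [l..<n] (fold \<phi> [m..<l] x) = fold \<phi> [m..<n] x"
  by (metis comp_apply fold_append le_Suc_ex upt_add_eq_append)

text \<open>Equality at one stage persists at all later ones, so "at some stage" may be read as "at
  all late stages". In this form finitely many equations combine by \<open>eventually_elim\<close>
  without explicit maxima.\<close>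

lemma mem_rel_iff:
  "((m, x), (n, y)) \<in> direct_limit_rel A \<phi> \<longleftrightarrow> x \<in> carrier (A m) \<and> y \<in> carrier (A n) \<and>
    eventually (\<lambda>l. fold \<phi> [m..<l] x = fold \<phi> [n..<l] y) sequentially"
proof -
  have "fold \<phi> [m..<k] x = fold \<phi> [n..<k] y"
    if "fold \<phi> [m..<l] x = fold \<phi> [n..<l] y" "max m n \<le> l" "l \<le> k" for l k
    using that by (metis fold_fold max.bounded_iff)
  moreover have "\<exists>l\<ge>max m n. fold \<phi> [m..<l] x = fold \<phi> [n..<l] y"
    if "\<forall>k\<ge>N. fold \<phi> [m..<k] x = fold \<phi> [n..<k] y" for N
    using that by (intro exI[of _ "max N (max m n)"]) auto
  ultimately show ?thesis
    unfolding direct_limit_rel_def eventually_sequentially by blast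
qed

lemma equiv_rel: "equiv (SIGMA n:UNIV. carrier (A n)) (direct_limit_rel A \<phi>)"
proof (intro equivI)
  show "direct_limit_rel A \<phi> \<subseteq> (SIGMA n:UNIV. carrier (A n)) \<times> (SIGMA n:UNIV. carrier (A n))"
    by (auto simp: direct_limit_rel_def)
  show "refl_on (SIGMA n:UNIV. carrier (A n)) (direct_limit_rel A \<phi>)"
    by (intro refl_onI) (auto simp: mem_rel_iff)
  show "sym (direct_limit_rel A \<phi>)"
    by (intro symI) (auto simp: mem_rel_iff elim!: eventually_mono)
  show "trans (direct_limit_rel A \<phi>)"
  proof (rule transI, clarify)
    fix k x l y m z
    assume "((k, x), (l, y)) \<in> direct_limit_rel A \<phi>" "((l, y), (m, z)) \<in> direct_limit_rel A \<phi>"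
    moreover from this have "eventually (\<lambda>j. fold \<phi> [k..<j] x = fold \<phi> [l..<j] y) sequentially"
      "eventually (\<lambda>j. fold \<phi> [l..<j] y = fold \<phi> [m..<j] z) sequentially"
      by (simp_all add: mem_rel_iff)
    then have "eventually (\<lambda>j. fold \<phi> [k..<j] x = fold \<phi> [m..<j] z) sequentially"
      by eventually_elim simp
    ultimately show "((k, x), (m, z)) \<in> direct_limit_rel A \<phi>"
      by (simp add: mem_rel_iff)
  qed
qed

abbreviation cls :: "nat \<Rightarrow> 'a \<Rightarrow> (nat \<times> 'a) set" where
  "cls n x \<equiv> direct_limit_rel A \<phi> `` {(n, x)}"

lemma cls_eq_iff:
  "\<lbrakk>x \<in> carrier (A m); y \<in> carrier (A n)\<rbrakk> \<Longrightarrow> cls m x = cls n y \<longleftrightarrow>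
    eventually (\<lambda>l. fold \<phi> [m..<l] x = fold \<phi> [n..<l] y) sequentially"
  by (subst eq_equiv_class_iff[OF equiv_rel]) (auto simp: mem_rel_iff)

lemma cls_fold:
  assumes "m \<le> n" "x \<in> carrier (A m)"
  shows "cls n (fold \<phi> [m..<n] x) = cls m x"
  using assms
  by (auto simp: cls_eq_iff fold_closed fold_fold eventually_sequentially intro!: exI[of _ n])

lemma carrier_limitE:
  assumes "X \<in> carrier (direct_limit A \<phi>)"
  obtains n x where "x \<in> carrier (A n)" "X = cls n x"
  using assms by (auto simp: direct_limit_def elim!: quotientE)

text \<open>The product in \<open>direct_limit\<close> is a union over all pairs of representatives
  at a common stage. The products of any two such pairs become equal at a late stage, so the union
  is a single class.\<close>

lemma cls_mult:
  assumes x: "x \<in> carrier (A n)" and y: "y \<in> carrier (A n)"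
  shows "cls n x \<otimes>\<^bsub>direct_limit A \<phi>\<^esub> cls n y = cls n (x \<otimes>\<^bsub>A n\<^esub> y)"
proof -
  have "cls m (x' \<otimes>\<^bsub>A m\<^esub> y') = cls n (x \<otimes>\<^bsub>A n\<^esub> y)"
    if x': "(m, x') \<in> cls n x" and y': "(m, y') \<in> cls n y" for m x' y'
  proof -
    have carr: "x' \<in> carrier (A m)" "y' \<in> carrier (A m)"
      using x' y' by (auto simp: mem_rel_iff)
    have "eventually (\<lambda>l. fold \<phi> [n..<l] x = fold \<phi> [m..<l] x') sequentially"
      "eventually (\<lambda>l. fold \<phi> [n..<l] y = fold \<phi> [m..<l] y') sequentially"
      using x' y' by (auto simp: mem_rel_iff)
    with eventually_ge_at_top[of m] eventually_ge_at_top[of n]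
    have "eventually (\<lambda>l. fold \<phi> [m..<l] (x' \<otimes>\<^bsub>A m\<^esub> y') = fold \<phi> [n..<l] (x \<otimes>\<^bsub>A n\<^esub> y)) sequentially"
      by eventually_elim (simp add: fold_mult carr x y)
    then show ?thesis
      using carr x y by (subst cls_eq_iff) (auto intro: nonunital_algebra.mult_closed[OF algebra])
  qed
  moreover have "(n, x) \<in> cls n x" "(n, y) \<in> cls n y"
    using x y by (auto simp: mem_rel_iff)
  ultimately have "{cls m (x' \<otimes>\<^bsub>A m\<^esub> y') | m x' y'. (m, x') \<in> cls n x \<and> (m, y') \<in> cls n y}
      = {cls n (x \<otimes>\<^bsub>A n\<^esub> y)}"
    by blast
  then show ?thesis
    by (simp add: direct_limit_def)
qed

lemma corner_finite_direct_limit: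
  assumes fin: "\<And>n. corner_finite (A n)"
  shows "corner_finite (direct_limit A \<phi>)"
  unfolding corner_finite_def
proof (intro ballI impI)
  let ?L = "direct_limit A \<phi>"
  fix F X Y
  assume F: "F \<in> carrier ?L" and X: "X \<in> carrier ?L" and Y: "Y \<in> carrier ?L"
    and eqs: "F \<otimes>\<^bsub>?L\<^esub> F = F" "F \<otimes>\<^bsub>?L\<^esub> X = X" "X \<otimes>\<^bsub>?L\<^esub> F = X" "F \<otimes>\<^bsub>?L\<^esub> Y = Y"
      "Y \<otimes>\<^bsub>?L\<^esub> F = Y" "Y \<otimes>\<^bsub>?L\<^esub> X = F"
  obtain k f l x m y where
    f: "f \<in> carrier (A k)" "F = cls k f" and
    x: "x \<in> carrier (A l)" "X = cls l x" and
    y: "y \<in> carrier (A m)" "Y = cls m y"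
    using F X Y by (metis carrier_limitE)
  define N where "N = max k (max l m)"
  have N: "k \<le> N" "l \<le> N" "m \<le> N"
    by (auto simp: N_def)
  define f' x' y' where "f' = fold \<phi> [k..<N] f" and "x' = fold \<phi> [l..<N] x" and "y' = fold \<phi> [m..<N] y"
  have carr: "f' \<in> carrier (A N)" "x' \<in> carrier (A N)" "y' \<in> carrier (A N)"
    using f x y N by (auto simp: f'_def x'_def y'_def fold_closed)
  have reps: "F = cls N f'" "X = cls N x'" "Y = cls N y'"
    using f x y N by (auto simp: f'_def x'_def y'_def cls_fold)
  \<comment> \<open>An equation between products in the limit becomes an equation between
    representatives at every late stage \<open>j\<close>.\<close>
  have lift: "eventually (\<lambda>j. fold \<phi> [N..<j] a \<otimes>\<^bsub>A j\<^esub> fold \<phi> [N..<j] b = fold \<phi> [N..<j] c) sequentially"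
    if "cls N a \<otimes>\<^bsub>?L\<^esub> cls N b = cls N c" "a \<in> carrier (A N)" "b \<in> carrier (A N)" "c \<in> carrier (A N)"
    for a b c
  proof -
    have "eventually (\<lambda>j. fold \<phi> [N..<j] (a \<otimes>\<^bsub>A N\<^esub> b) = fold \<phi> [N..<j] c) sequentially"
      using that by (simp add: cls_mult cls_eq_iff nonunital_algebra.mult_closed[OF algebra])
    with eventually_ge_at_top[of N] show ?thesis
      by eventually_elim (use that in \<open>simp add: fold_mult\<close>)
  qed
  \<comment> \<open>At a late stage all six equations hold at once, so corner finiteness of
    \<open>A j\<close> gives the seventh; passing to classes transfers it to the limit.\<close>
  have "eventually (\<lambda>j. fold \<phi> [N..<j] (x' \<otimes>\<^bsub>A N\<^esub> y') = fold \<phi> [N..<j] f') sequentially"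
    using lift[OF eqs(1)[unfolded reps] carr(1) carr(1) carr(1)]
      lift[OF eqs(2)[unfolded reps] carr(1) carr(2) carr(2)]
      lift[OF eqs(3)[unfolded reps] carr(2) carr(1) carr(2)]
      lift[OF eqs(4)[unfolded reps] carr(1) carr(3) carr(3)]
      lift[OF eqs(5)[unfolded reps] carr(3) carr(1) carr(3)]
      lift[OF eqs(6)[unfolded reps] carr(3) carr(2) carr(1)]
      eventually_ge_at_top[of N]
  proof eventually_elim
    case (elim j)
    show ?case
      by (subst fold_mult[OF \<open>N \<le> j\<close> carr(2,3)], rule corner_finiteD[OF fin])
        (use elim carr in \<open>simp_all add: fold_closed\<close>)
  qed
  then have "cls N (x' \<otimes>\<^bsub>A N\<^esub> y') = cls N f'"
    by (subst cls_eq_iff) (use carr in \<open>simp_all add: nonunital_algebra.mult_closed[OF algebra]\<close>)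
  then show "X \<otimes>\<^bsub>?L\<^esub> Y = F"
    unfolding reps cls_mult[OF carr(2,3)] .
qed

end

lemma corner_finite_ultramatricial:
  fixes B :: "('f::field, 'b) module"
  assumes "ultramatricial B"
  shows "corner_finite B"
proof -
  obtain A :: "nat \<Rightarrow> ('f, 'f mat list) module" and \<phi> where
    B: "nonunital_algebra B" "algebra_isomorphic B (direct_limit A \<phi>)"
    and A: "\<And>n. matricial (A n)" and hom: "\<And>n. \<phi> n \<in> algebra_hom (A n) (A (Suc n))"
    using assms unfolding ultramatricial_def by blast
  interpret direct_system A \<phi>
    using A hom by (intro direct_system.intro) (simp_all add: matricial_def)
  have "corner_finite (A n)" for n
  proof -
    obtain ns where "algebra_isomorphic (A n) (matrix_sum ns)"
      using A[of n] unfolding matricial_def by blast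
    then show ?thesis
    proof (rule corner_finite_isomorphic)
      show "corner_finite (matrix_sum ns :: ('f, 'f mat list) module)"
        by (rule corner_finite_matrix_sum)
      show "x \<otimes>\<^bsub>A n\<^esub> y \<in> carrier (A n)" if "x \<in> carrier (A n)" "y \<in> carrier (A n)" for x y
        using algebra that by (rule nonunital_algebra.mult_closed)
    qed
  qed
  then have "corner_finite (direct_limit A \<phi>)"
    by (rule corner_finite_direct_limit)
  with B(2) show ?thesis
    by (rule corner_finite_isomorphic) (rule nonunital_algebra.mult_closed[OF B(1)])
qed

section \<open>Factorizations and infinite paths\<close>

lemma degree_diff_add:
  fixes m n :: "'k \<Rightarrow> nat"
  shows "m \<le> n \<Longrightarrow> m + (n - m) = n"
  by (rule ext) (simp add: le_fun_def)

lemma degree_add_left_cancel: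
  fixes n m m' :: "'k \<Rightarrow> nat"
  shows "n + m = n + m' \<longleftrightarrow> m = m'"
  by (auto simp: fun_eq_iff)

context k_graph
begin

text \<open>The initial-segment order replaces the description of \<open>segment\<close> by
  \<open>THE\<close>; \<open>prefix_segment\<close> connects the two.\<close>

definition prefix :: "'e \<Rightarrow> 'e \<Rightarrow> bool" where
  "prefix \<alpha> \<gamma> \<longleftrightarrow> \<alpha> \<in> paths \<Lambda> \<and> (\<exists>\<beta> \<in> paths \<Lambda>. src \<Lambda> \<alpha> = rng \<Lambda> \<beta> \<and> \<gamma> = compose \<Lambda> \<alpha> \<beta>)"

lemma factor_exists:
  assumes "\<gamma> \<in> paths \<Lambda>" "deg \<Lambda> \<gamma> = n + m"
  obtains \<alpha> \<beta> where "\<alpha> \<in> paths \<Lambda>" "\<beta> \<in> paths \<Lambda>" "deg \<Lambda> \<alpha> = n" "deg \<Lambda> \<beta> = m"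
    "src \<Lambda> \<alpha> = rng \<Lambda> \<beta>" "\<gamma> = compose \<Lambda> \<alpha> \<beta>"
  using unique_factorization[OF assms] by blast

text \<open>The factorization property is unique for a fixed pair of degrees. Cancellation of
  degrees shows that the tails have equal degree as well, so prescribing the degree of the heads is
  enough.\<close>

lemma factor_unique:
  assumes "\<alpha> \<in> paths \<Lambda>" "\<beta> \<in> paths \<Lambda>" "src \<Lambda> \<alpha> = rng \<Lambda> \<beta>"
    and "\<alpha>' \<in> paths \<Lambda>" "\<beta>' \<in> paths \<Lambda>" "src \<Lambda> \<alpha>' = rng \<Lambda> \<beta>'"
    and eq: "compose \<Lambda> \<alpha> \<beta> = compose \<Lambda> \<alpha>' \<beta>'" and deg: "deg \<Lambda> \<alpha> = deg \<Lambda> \<alpha>'"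
  shows "\<alpha> = \<alpha>'" "\<beta> = \<beta>'"
proof -
  have "deg \<Lambda> \<alpha> + deg \<Lambda> \<beta> = deg \<Lambda> \<alpha>' + deg \<Lambda> \<beta>'"
    using assms deg_compose by metis
  then have "deg \<Lambda> \<beta> = deg \<Lambda> \<beta>'"
    using deg by (simp add: degree_add_left_cancel)
  have "compose \<Lambda> \<alpha> \<beta> \<in> paths \<Lambda>" "deg \<Lambda> (compose \<Lambda> \<alpha> \<beta>) = deg \<Lambda> \<alpha> + deg \<Lambda> \<beta>"
    using assms(1-3) by (simp_all add: compose_closed deg_compose)
  then have "\<exists>!(a, b). a \<in> paths \<Lambda> \<and> b \<in> paths \<Lambda> \<and> deg \<Lambda> a = deg \<Lambda> \<alpha> \<and> deg \<Lambda> b = deg \<Lambda> \<beta> \<and>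
      src \<Lambda> a = rng \<Lambda> b \<and> compose \<Lambda> \<alpha> \<beta> = compose \<Lambda> a b" (is "\<exists>!p. ?Q p")
    by (rule unique_factorization)
  moreover have "?Q (\<alpha>, \<beta>)" "?Q (\<alpha>', \<beta>')"
    using assms \<open>deg \<Lambda> \<beta> = deg \<Lambda> \<beta>'\<close> by auto
  ultimately have "(\<alpha>, \<beta>) = (\<alpha>', \<beta>')"
    by blast
  then show "\<alpha> = \<alpha>'" "\<beta> = \<beta>'"
    by simp_all
qed

text \<open>Composing \<alpha> with an identity on the right and on the left gives two
  factorizations of \<alpha> with heads of degree 0, so the heads coincide.\<close>

lemma deg_zero_ident:
  assumes "\<alpha> \<in> paths \<Lambda>" "deg \<Lambda> \<alpha> = 0"
  shows "\<alpha> = ident \<Lambda> (rng \<Lambda> \<alpha>)"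
  by (rule factor_unique(1)[of \<alpha> "ident \<Lambda> (src \<Lambda> \<alpha>)" "ident \<Lambda> (rng \<Lambda> \<alpha>)" \<alpha>])
    (simp_all add: assms ident_closed src_closed rng_closed rng_ident src_ident ident_left ident_right deg_ident)

lemma ident_inject: "\<lbrakk>u \<in> verts \<Lambda>; v \<in> verts \<Lambda>\<rbrakk> \<Longrightarrow> ident \<Lambda> u = ident \<Lambda> v \<longleftrightarrow> u = v"
  by (metis rng_ident)

lemma paths_from_zero: "v \<in> verts \<Lambda> \<Longrightarrow> paths_from \<Lambda> v 0 = {ident \<Lambda> v}"
  using deg_zero_ident by (auto simp: paths_from_def ident_closed rng_ident deg_ident)

lemma prefix_closed: "prefix \<alpha> \<gamma> \<Longrightarrow> \<alpha> \<in> paths \<Lambda>" "prefix \<alpha> \<gamma> \<Longrightarrow> \<gamma> \<in> paths \<Lambda>"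
  by (auto simp: prefix_def compose_closed)

lemma prefix_compose: "\<lbrakk>\<alpha> \<in> paths \<Lambda>; \<beta> \<in> paths \<Lambda>; src \<Lambda> \<alpha> = rng \<Lambda> \<beta>\<rbrakk> \<Longrightarrow> prefix \<alpha> (compose \<Lambda> \<alpha> \<beta>)"
  by (auto simp: prefix_def)

lemma prefixE:
  assumes "prefix \<alpha> \<gamma>"
  obtains \<beta> where "\<alpha> \<in> paths \<Lambda>" "\<beta> \<in> paths \<Lambda>" "src \<Lambda> \<alpha> = rng \<Lambda> \<beta>" "\<gamma> = compose \<Lambda> \<alpha> \<beta>"
  using assms by (auto simp: prefix_def)

lemma prefix_refl: "\<alpha> \<in> paths \<Lambda> \<Longrightarrow> prefix \<alpha> \<alpha>"
  using prefix_compose[of \<alpha> "ident \<Lambda> (src \<Lambda> \<alpha>)"]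
  by (simp add: ident_closed src_closed rng_ident ident_right)

lemma prefix_trans: "prefix \<alpha> \<beta> \<Longrightarrow> prefix \<beta> \<gamma> \<Longrightarrow> prefix \<alpha> \<gamma>"
  by (elim prefixE) (auto simp: prefix_def compose_assoc compose_closed rng_compose src_compose
      intro!: bexI[of _ "compose \<Lambda> _ _"])

lemma prefix_rng: "prefix \<alpha> \<gamma> \<Longrightarrow> rng \<Lambda> \<alpha> = rng \<Lambda> \<gamma>"
  by (auto simp: prefix_def rng_compose)

lemma prefix_compose_left:
  assumes "prefix \<beta> \<gamma>" "\<alpha> \<in> paths \<Lambda>" "src \<Lambda> \<alpha> = rng \<Lambda> \<gamma>"
  shows "prefix (compose \<Lambda> \<alpha> \<beta>) (compose \<Lambda> \<alpha> \<gamma>)"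
proof -
  obtain \<delta> where "\<beta> \<in> paths \<Lambda>" "\<delta> \<in> paths \<Lambda>" "src \<Lambda> \<beta> = rng \<Lambda> \<delta>" "\<gamma> = compose \<Lambda> \<beta> \<delta>"
    using assms(1) by (rule prefixE)
  then show ?thesis
    using assms(2,3) prefix_compose[of "compose \<Lambda> \<alpha> \<beta>" \<delta>]
    by (simp add: compose_assoc compose_closed rng_compose src_compose)
qed

lemma prefix_unique: "\<lbrakk>prefix \<alpha> \<gamma>; prefix \<beta> \<gamma>; deg \<Lambda> \<alpha> = deg \<Lambda> \<beta>\<rbrakk> \<Longrightarrow> \<alpha> = \<beta>"
  by (elim prefixE) (metis factor_unique(1))

lemma prefix_exists:
  assumes "\<gamma> \<in> paths \<Lambda>" "n \<le> deg \<Lambda> \<gamma>"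
  obtains \<alpha> where "prefix \<alpha> \<gamma>" "deg \<Lambda> \<alpha> = n"
  using assms factor_exists[of \<gamma> n "deg \<Lambda> \<gamma> - n"] prefix_compose by (metis degree_diff_add)

text \<open>The initial segment of \<beta> that has the degree of \<alpha> is also one of \<gamma>,
  hence is \<alpha> itself.\<close>

lemma prefix_of_prefix:
  assumes "prefix \<alpha> \<gamma>" "prefix \<beta> \<gamma>" "deg \<Lambda> \<alpha> \<le> deg \<Lambda> \<beta>"
  shows "prefix \<alpha> \<beta>"
  using assms by (metis prefix_closed(2) prefix_closed(1) prefix_exists prefix_trans prefix_unique)

lemma prefix_segment:
  assumes "\<gamma> \<in> paths \<Lambda>" "n \<le> deg \<Lambda> \<gamma>"
  shows "prefix (segment \<Lambda> \<gamma> 0 n) \<gamma>" "deg \<Lambda> (segment \<Lambda> \<gamma> 0 n) = n"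
proof -
  \<comment> \<open>\<open>P\<close> is the predicate under \<open>THE\<close> in
    \<open>segment\<close> with lower bound 0. The head then has degree 0 and is an identity, so
    \<open>P\<close> singles out the initial segment of degree \<open>n\<close>.\<close>
  define P where "P = (\<lambda>\<tau>. \<tau> \<in> paths \<Lambda> \<and> deg \<Lambda> \<tau> = n - 0 \<and>
    (\<exists>\<alpha> \<in> paths \<Lambda>. \<exists>\<beta> \<in> paths \<Lambda>. deg \<Lambda> \<alpha> = 0 \<and> deg \<Lambda> \<beta> = deg \<Lambda> \<gamma> - n \<and>
      src \<Lambda> \<alpha> = rng \<Lambda> \<tau> \<and> src \<Lambda> \<tau> = rng \<Lambda> \<beta> \<and> \<gamma> = compose \<Lambda> (compose \<Lambda> \<alpha> \<tau>) \<beta>))"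
  have n0: "n - 0 = n"
    by (simp add: fun_eq_iff)
  have P: "prefix \<tau> \<gamma> \<and> deg \<Lambda> \<tau> = n" if P\<tau>: "P \<tau>" for \<tau>
  proof -
    obtain \<alpha> \<beta> where *: "\<alpha> \<in> paths \<Lambda>" "\<beta> \<in> paths \<Lambda>" "deg \<Lambda> \<alpha> = 0" "src \<Lambda> \<alpha> = rng \<Lambda> \<tau>"
      "src \<Lambda> \<tau> = rng \<Lambda> \<beta>" "\<gamma> = compose \<Lambda> (compose \<Lambda> \<alpha> \<tau>) \<beta>"
      using P\<tau> unfolding P_def by blast
    have "compose \<Lambda> \<alpha> \<tau> = \<tau>"
      using * P\<tau> deg_zero_ident[of \<alpha>] ident_left[of \<tau>] src_ident[of "rng \<Lambda> \<alpha>"] rng_closed[of \<alpha>]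
      unfolding P_def by metis
    then show ?thesis
      using * P\<tau> prefix_compose[of \<tau> \<beta>] unfolding P_def n0 by simp
  qed
  obtain \<alpha> \<beta> where *: "\<alpha> \<in> paths \<Lambda>" "\<beta> \<in> paths \<Lambda>" "deg \<Lambda> \<alpha> = n" "deg \<Lambda> \<beta> = deg \<Lambda> \<gamma> - n"
    "src \<Lambda> \<alpha> = rng \<Lambda> \<beta>" "\<gamma> = compose \<Lambda> \<alpha> \<beta>"
    using factor_exists[OF assms(1), of n "deg \<Lambda> \<gamma> - n"] assms(2) by (metis degree_diff_add)
  have "P \<alpha>"
    unfolding P_def n0
    using * by (intro conjI bexI[of _ "ident \<Lambda> (rng \<Lambda> \<alpha>)"] bexI[of _ \<beta>])
      (simp_all add: ident_closed rng_closed deg_ident src_ident ident_left)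
  then have "P (segment \<Lambda> \<gamma> 0 n)"
    using P prefix_unique unfolding segment_def P_def[symmetric] by (metis theI)
  then show "prefix (segment \<Lambda> \<gamma> 0 n) \<gamma>" "deg \<Lambda> (segment \<Lambda> \<gamma> 0 n) = n"
    using P by blast+
qed

lemma MCE_prefix:
  assumes "\<kappa> \<in> MCE \<Lambda> \<mu> \<nu>"
  shows "prefix \<mu> \<kappa>" "prefix \<nu> \<kappa>"
  using assms prefix_segment(1)[of \<kappa> "deg \<Lambda> \<mu>"] prefix_segment(1)[of \<kappa> "deg \<Lambda> \<nu>"]
  by (auto simp: MCE_def)

lemma generalized_cycle_MCE:
  assumes "generalized_cycle \<Lambda> \<mu> \<nu>" "\<tau> \<in> paths \<Lambda>" "rng \<Lambda> \<tau> = src \<Lambda> \<mu>"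
  obtains \<kappa> where "prefix (compose \<Lambda> \<mu> \<tau>) \<kappa>" "prefix \<nu> \<kappa>"
    "deg \<Lambda> \<kappa> = sup (deg \<Lambda> (compose \<Lambda> \<mu> \<tau>)) (deg \<Lambda> \<nu>)"
proof -
  obtain \<kappa> where "\<kappa> \<in> MCE \<Lambda> (compose \<Lambda> \<mu> \<tau>) \<nu>"
    using assms unfolding generalized_cycle_def by blast
  then show ?thesis
    using that MCE_prefix unfolding MCE_def by blast
qed

section \<open>Infinite paths\<close>

text \<open>An infinite path is represented by the set of its finite initial segments.\<close>

definition infinite_paths :: "'e set set" where
  "infinite_paths = {x. x \<subseteq> paths \<Lambda> \<and> (\<forall>\<alpha> \<gamma>. prefix \<alpha> \<gamma> \<longrightarrow> \<gamma> \<in> x \<longrightarrow> \<alpha> \<in> x) \<and>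
     (\<forall>n. \<exists>!\<alpha>. \<alpha> \<in> x \<and> deg \<Lambda> \<alpha> = n)}"

text \<open>The products \<alpha>\<beta> only have degrees at least d(\<alpha>); taking their
  initial segments supplies the other degrees.\<close>

definition path_concat :: "'e \<Rightarrow> 'e set \<Rightarrow> 'e set" where
  "path_concat \<alpha> x = {\<gamma>. \<exists>\<beta> \<in> x. src \<Lambda> \<alpha> = rng \<Lambda> \<beta> \<and> prefix \<gamma> (compose \<Lambda> \<alpha> \<beta>)}"

definition path_drop :: "'e \<Rightarrow> 'e set \<Rightarrow> 'e set" where
  "path_drop \<alpha> x = {\<beta> \<in> paths \<Lambda>. src \<Lambda> \<alpha> = rng \<Lambda> \<beta> \<and> compose \<Lambda> \<alpha> \<beta> \<in> x}"

lemma infinite_pathD: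
  assumes "x \<in> infinite_paths"
  shows "\<alpha> \<in> x \<Longrightarrow> \<alpha> \<in> paths \<Lambda>"
    and "prefix \<alpha> \<gamma> \<Longrightarrow> \<gamma> \<in> x \<Longrightarrow> \<alpha> \<in> x"
    and "\<alpha> \<in> x \<Longrightarrow> \<beta> \<in> x \<Longrightarrow> deg \<Lambda> \<alpha> = deg \<Lambda> \<beta> \<Longrightarrow> \<alpha> = \<beta>"
    and "\<exists>\<alpha>\<in>x. deg \<Lambda> \<alpha> = n"
  using assms unfolding infinite_paths_def by blast+

lemma infinite_path_prefix:
  assumes "x \<in> infinite_paths" "\<alpha> \<in> x" "\<beta> \<in> x" "deg \<Lambda> \<alpha> \<le> deg \<Lambda> \<beta>"
  shows "prefix \<alpha> \<beta>"
  using assms by (metis infinite_pathD prefix_exists)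

lemma infinite_path_directed:
  assumes "x \<in> infinite_paths" "\<alpha> \<in> x" "\<beta> \<in> x"
  obtains \<gamma> where "\<gamma> \<in> x" "prefix \<alpha> \<gamma>" "prefix \<beta> \<gamma>"
  using assms infinite_pathD(4)[OF assms(1), of "sup (deg \<Lambda> \<alpha>) (deg \<Lambda> \<beta>)"]
  by (metis infinite_path_prefix sup_ge1 sup_ge2)

text \<open>Both sets have exactly one member of each degree, so no inclusion can be strict. The
  equalities below therefore need one direction only.\<close>

lemma infinite_path_eqI: "\<lbrakk>x \<in> infinite_paths; y \<in> infinite_paths; x \<subseteq> y\<rbrakk> \<Longrightarrow> x = y"
  by (metis infinite_pathD(3,4) subsetD subsetI subset_antisym)

text \<open>\<open>ident \<Lambda> v \<in> x\<close> is the way to say that the infinite path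
  \<open>x\<close> starts at \<open>v\<close>: its member of degree 0 is an initial segment of all
  the others, which thus share its range.\<close>

lemma infinite_path_rng:
  assumes "x \<in> infinite_paths" "\<alpha> \<in> x" "v \<in> verts \<Lambda>"
  shows "ident \<Lambda> v \<in> x \<longleftrightarrow> v = rng \<Lambda> \<alpha>"
proof
  assume "ident \<Lambda> v \<in> x"
  then have "prefix (ident \<Lambda> v) \<alpha>"
    by (intro infinite_path_prefix[OF assms(1) _ assms(2)]) (auto simp: deg_ident[OF assms(3)] le_fun_def)
  then show "v = rng \<Lambda> \<alpha>"
    using prefix_rng rng_ident assms(3) by metis
next
  have "prefix (ident \<Lambda> (rng \<Lambda> \<alpha>)) \<alpha>"
    using assms infinite_pathD(1) prefix_compose[of "ident \<Lambda> (rng \<Lambda> \<alpha>)" \<alpha>]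
    by (simp add: ident_closed rng_closed src_ident ident_left)
  then show "v = rng \<Lambda> \<alpha> \<Longrightarrow> ident \<Lambda> v \<in> x"
    using assms infinite_pathD(2) by blast
qed

lemma path_concat_infinite:
  assumes x: "x \<in> infinite_paths" and \<alpha>: "\<alpha> \<in> paths \<Lambda>" and v: "ident \<Lambda> (src \<Lambda> \<alpha>) \<in> x"
  shows "path_concat \<alpha> x \<in> infinite_paths"
proof -
  have src: "src \<Lambda> \<alpha> = rng \<Lambda> \<beta>" if "\<beta> \<in> x" for \<beta>
    using x \<alpha> v that infinite_path_rng src_closed by blast
  have ex: "\<exists>\<gamma>. \<gamma> \<in> path_concat \<alpha> x \<and> deg \<Lambda> \<gamma> = n" for n
  proof -
    obtain \<beta> where \<beta>: "\<beta> \<in> x" "deg \<Lambda> \<beta> = n"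
      using infinite_pathD(4)[OF x] by blast
    then have "compose \<Lambda> \<alpha> \<beta> \<in> paths \<Lambda>" "n \<le> deg \<Lambda> (compose \<Lambda> \<alpha> \<beta>)"
      using \<alpha> src x infinite_pathD(1) by (auto simp: compose_closed deg_compose le_fun_def)
    then show ?thesis
      using \<beta> src unfolding path_concat_def by (metis (mono_tags, lifting) mem_Collect_eq prefix_exists)
  qed
  have uniq: "\<gamma> = \<gamma>'" if \<gamma>: "\<gamma> \<in> path_concat \<alpha> x" "\<gamma>' \<in> path_concat \<alpha> x" "deg \<Lambda> \<gamma> = deg \<Lambda> \<gamma>'" for \<gamma> \<gamma>'
  proof -
    obtain \<beta> \<beta>' where \<beta>: "\<beta> \<in> x" "prefix \<gamma> (compose \<Lambda> \<alpha> \<beta>)" "\<beta>' \<in> x" "prefix \<gamma>' (compose \<Lambda> \<alpha> \<beta>')"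
      using \<gamma> by (auto simp: path_concat_def)
    \<comment> \<open>Directedness puts both paths below the single product \<alpha>\<delta>, where
      initial segments of equal degree agree.\<close>
    obtain \<delta> where \<delta>: "\<delta> \<in> x" "prefix \<beta> \<delta>" "prefix \<beta>' \<delta>"
      using infinite_path_directed[OF x \<beta>(1,3)] .
    have "prefix \<gamma> (compose \<Lambda> \<alpha> \<delta>)" "prefix \<gamma>' (compose \<Lambda> \<alpha> \<delta>)"
      using \<beta> \<delta> prefix_compose_left prefix_trans \<alpha> src by blast+
    then show ?thesis
      using \<gamma>(3) prefix_unique by blast
  qed
  show ?thesis
    unfolding infinite_paths_def
    using ex uniq by (auto simp: path_concat_def dest: prefix_closed intro: prefix_trans)
qed

lemma path_drop_infinite:
  assumes x: "x \<in> infinite_paths" and \<alpha>: "\<alpha> \<in> x"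
  shows "path_drop \<alpha> x \<in> infinite_paths"
proof -
  have \<alpha>': "\<alpha> \<in> paths \<Lambda>"
    using x \<alpha> infinite_pathD(1) by blast
  have ex: "\<exists>\<beta>. \<beta> \<in> path_drop \<alpha> x \<and> deg \<Lambda> \<beta> = n" for n
  proof -
    \<comment> \<open>The member of degree d(\<alpha>) + n extends \<alpha>, and what remains after
      \<alpha> has degree n.\<close>
    obtain \<gamma> where \<gamma>: "\<gamma> \<in> x" "deg \<Lambda> \<gamma> = deg \<Lambda> \<alpha> + n"
      using infinite_pathD(4)[OF x] by blast
    then have "prefix \<alpha> \<gamma>"
      by (intro infinite_path_prefix[OF x \<alpha>]) (auto simp: le_fun_def)
    then obtain \<beta> where \<beta>: "\<beta> \<in> paths \<Lambda>" "src \<Lambda> \<alpha> = rng \<Lambda> \<beta>" "\<gamma> = compose \<Lambda> \<alpha> \<beta>"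
      by (auto elim: prefixE)
    then have "deg \<Lambda> \<beta> = n"
      using \<gamma>(2) \<alpha>' by (simp add: deg_compose degree_add_left_cancel)
    then show ?thesis
      using \<beta> \<gamma> by (auto simp: path_drop_def)
  qed
  have uniq: "\<beta> = \<beta>'" if "\<beta> \<in> path_drop \<alpha> x" "\<beta>' \<in> path_drop \<alpha> x" "deg \<Lambda> \<beta> = deg \<Lambda> \<beta>'" for \<beta> \<beta>'
    using that \<alpha>' infinite_pathD(3)[OF x, of "compose \<Lambda> \<alpha> \<beta>" "compose \<Lambda> \<alpha> \<beta>'"] factor_unique(2)[of \<alpha> \<beta> \<alpha> \<beta>']
    by (auto simp: path_drop_def deg_compose)
  have "\<beta> \<in> path_drop \<alpha> x" if "prefix \<beta> \<beta>'" "\<beta>' \<in> path_drop \<alpha> x" for \<beta> \<beta>'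
    using that \<alpha>' prefix_compose_left[of \<beta> \<beta>' \<alpha>] infinite_pathD(2)[OF x] prefix_closed prefix_rng
    by (auto simp: path_drop_def)
  then show ?thesis
    unfolding infinite_paths_def using ex uniq by (auto simp: path_drop_def)
qed

lemma mem_path_concat:
  assumes x: "x \<in> infinite_paths" and \<alpha>: "\<alpha> \<in> paths \<Lambda>" and v: "ident \<Lambda> (src \<Lambda> \<alpha>) \<in> x"
  shows "\<alpha> \<in> path_concat \<alpha> x"
  unfolding path_concat_def using prefix_refl[OF \<alpha>] v ident_right[OF \<alpha>] rng_ident src_closed[OF \<alpha>]
  by (auto intro!: bexI[of _ "ident \<Lambda> (src \<Lambda> \<alpha>)"])

lemma path_drop_concat:
  assumes x: "x \<in> infinite_paths" and \<alpha>: "\<alpha> \<in> paths \<Lambda>" and v: "ident \<Lambda> (src \<Lambda> \<alpha>) \<in> x"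
  shows "path_drop \<alpha> (path_concat \<alpha> x) = x"
proof (rule infinite_path_eqI[symmetric, OF x path_drop_infinite])
  show "path_concat \<alpha> x \<in> infinite_paths" "\<alpha> \<in> path_concat \<alpha> x"
    using assms by (auto intro: path_concat_infinite mem_path_concat)
  have "src \<Lambda> \<alpha> = rng \<Lambda> \<beta>" if "\<beta> \<in> x" for \<beta>
    using x \<alpha> v that infinite_path_rng src_closed by blast
  then show "x \<subseteq> path_drop \<alpha> (path_concat \<alpha> x)"
    using infinite_pathD(1)[OF x] \<alpha> by (fastforce simp: path_drop_def path_concat_def intro: prefix_refl compose_closed)
qed

lemma path_drop_ident:
  assumes x: "x \<in> infinite_paths" and \<alpha>: "\<alpha> \<in> x"
  shows "ident \<Lambda> (src \<Lambda> \<alpha>) \<in> path_drop \<alpha> x"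
  using assms infinite_pathD(1) by (auto simp: path_drop_def ident_closed src_closed rng_ident ident_right)

lemma path_concat_drop:
  assumes x: "x \<in> infinite_paths" and \<alpha>: "\<alpha> \<in> x"
  shows "path_concat \<alpha> (path_drop \<alpha> x) = x"
proof (rule infinite_path_eqI[OF path_concat_infinite x])
  show "path_drop \<alpha> x \<in> infinite_paths" "\<alpha> \<in> paths \<Lambda>" "ident \<Lambda> (src \<Lambda> \<alpha>) \<in> path_drop \<alpha> x"
    using assms infinite_pathD(1) by (auto intro: path_drop_infinite path_drop_ident)
  show "path_concat \<alpha> (path_drop \<alpha> x) \<subseteq> x"
    using infinite_pathD(2)[OF x] by (auto simp: path_concat_def path_drop_def)
qed

lemma path_concat_compose:
  assumes x: "x \<in> infinite_paths" and \<alpha>: "\<alpha> \<in> paths \<Lambda>" and \<beta>: "\<beta> \<in> paths \<Lambda>" "src \<Lambda> \<alpha> = rng \<Lambda> \<beta>"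
    and v: "ident \<Lambda> (src \<Lambda> \<beta>) \<in> x"
  shows "path_concat (compose \<Lambda> \<alpha> \<beta>) x = path_concat \<alpha> (path_concat \<beta> x)"
proof (rule infinite_path_eqI)
  have \<beta>x: "path_concat \<beta> x \<in> infinite_paths" "\<beta> \<in> path_concat \<beta> x"
    using x \<beta> v by (auto intro: path_concat_infinite mem_path_concat)
  then have "ident \<Lambda> (src \<Lambda> \<alpha>) \<in> path_concat \<beta> x"
    using \<beta> \<alpha> infinite_path_rng src_closed by blast
  then show "path_concat \<alpha> (path_concat \<beta> x) \<in> infinite_paths"
    using \<beta>x \<alpha> path_concat_infinite by blast
  show "path_concat (compose \<Lambda> \<alpha> \<beta>) x \<in> infinite_paths"
    using x \<alpha> \<beta> v by (intro path_concat_infinite) (simp_all add: compose_closed src_compose)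
  show "path_concat (compose \<Lambda> \<alpha> \<beta>) x \<subseteq> path_concat \<alpha> (path_concat \<beta> x)"
  proof
    fix \<gamma> assume "\<gamma> \<in> path_concat (compose \<Lambda> \<alpha> \<beta>) x"
    then obtain \<delta> where \<delta>: "\<delta> \<in> x" "src \<Lambda> \<beta> = rng \<Lambda> \<delta>" "prefix \<gamma> (compose \<Lambda> (compose \<Lambda> \<alpha> \<beta>) \<delta>)"
      using \<alpha> \<beta> by (auto simp: path_concat_def src_compose)
    moreover have "\<delta> \<in> paths \<Lambda>"
      using \<delta> infinite_pathD(1)[OF x] by blast
    moreover have "compose \<Lambda> \<beta> \<delta> \<in> path_concat \<beta> x"
      using calculation \<beta> by (auto simp: path_concat_def intro: prefix_refl compose_closed)
    ultimately show "\<gamma> \<in> path_concat \<alpha> (path_concat \<beta> x)"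
      using \<alpha> \<beta> by (subst path_concat_def) (auto simp: compose_assoc rng_compose intro!: bexI[of _ "compose \<Lambda> \<beta> \<delta>"])
  qed
qed

text \<open>Without sources one can append a path of degree (1,...,1) again and again. The initial
  segments of the resulting chain form the infinite path, because the diagonal degrees (n,...,n) are
  cofinal.\<close>

lemma infinite_path_exists:
  assumes "row_finite_no_sources \<Lambda>" and v: "v \<in> verts \<Lambda>"
  obtains x where "x \<in> infinite_paths" "ident \<Lambda> v \<in> x"
proof -
  have "\<exists>p. \<forall>n. p n \<in> paths \<Lambda> \<and> deg \<Lambda> (p n) = (\<lambda>_. n) \<and> rng \<Lambda> (p n) = v \<and> prefix (p n) (p (Suc n))"
  proof -
    have "\<exists>p. \<forall>n. (p n \<in> paths \<Lambda> \<and> deg \<Lambda> (p n) = (\<lambda>_. n) \<and> rng \<Lambda> (p n) = v) \<and> prefix (p n) (p (Suc n))"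
    proof (rule dependent_nat_choice)
      show "\<exists>\<alpha>. \<alpha> \<in> paths \<Lambda> \<and> deg \<Lambda> \<alpha> = (\<lambda>_. 0) \<and> rng \<Lambda> \<alpha> = v"
        using v by (intro exI[of _ "ident \<Lambda> v"]) (auto simp: ident_closed deg_ident rng_ident)
    next
      fix \<alpha> n assume \<alpha>: "\<alpha> \<in> paths \<Lambda> \<and> deg \<Lambda> \<alpha> = (\<lambda>_. n) \<and> rng \<Lambda> \<alpha> = v"
      then obtain \<beta> where "\<beta> \<in> paths_from \<Lambda> (src \<Lambda> \<alpha>) 1"
        using assms(1) src_closed unfolding row_finite_no_sources_def by blast
      then show "\<exists>\<gamma>. (\<gamma> \<in> paths \<Lambda> \<and> deg \<Lambda> \<gamma> = (\<lambda>_. Suc n) \<and> rng \<Lambda> \<gamma> = v) \<and> prefix \<alpha> \<gamma>"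
        using \<alpha> by (intro exI[of _ "compose \<Lambda> \<alpha> \<beta>"])
          (auto simp: paths_from_def compose_closed rng_compose deg_compose prefix_compose fun_eq_iff)
    qed
    then show ?thesis by auto
  qed
  then obtain p where p: "\<And>n. p n \<in> paths \<Lambda>" "\<And>n. deg \<Lambda> (p n) = (\<lambda>_. n)" "\<And>n. rng \<Lambda> (p n) = v"
    and step: "\<And>n. prefix (p n) (p (Suc n))"
    by auto
  have mono: "prefix (p m) (p n)" if "m \<le> n" for m n
    using that by (induction n rule: dec_induct) (auto intro: prefix_refl p prefix_trans step)
  define x where "x = {\<alpha>. \<exists>n. prefix \<alpha> (p n)}"
  have ex: "\<exists>\<alpha>. \<alpha> \<in> x \<and> deg \<Lambda> \<alpha> = n" for n
  proof -
    \<comment> \<open>The index type is finite, so the largest coordinate of \<open>n\<close> exists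
      and bounds \<open>n\<close> by a diagonal degree.\<close>
    have "n \<le> deg \<Lambda> (p (Max (range n)))"
      by (auto simp: p le_fun_def)
    then show ?thesis
      using prefix_exists[OF p(1)] unfolding x_def by blast
  qed
  have uniq: "\<alpha> = \<beta>" if "\<alpha> \<in> x" "\<beta> \<in> x" "deg \<Lambda> \<alpha> = deg \<Lambda> \<beta>" for \<alpha> \<beta>
  proof -
    obtain m n where "prefix \<alpha> (p m)" "prefix \<beta> (p n)"
      using \<open>\<alpha> \<in> x\<close> \<open>\<beta> \<in> x\<close> by (auto simp: x_def)
    then have "prefix \<alpha> (p (max m n))" "prefix \<beta> (p (max m n))"
      using mono prefix_trans by (meson max.cobounded1 max.cobounded2)+
    then show ?thesis
      using that prefix_unique by blast
  qed
  have x: "x \<in> infinite_paths"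
    unfolding infinite_paths_def using ex uniq by (auto simp: x_def dest: prefix_closed intro: prefix_trans)
  moreover have "ident \<Lambda> v \<in> x"
    using infinite_path_rng[OF x _ v, of "p 0"] p(3) by (auto simp: x_def intro: prefix_refl p)
  ultimately show ?thesis
    using that by blast
qed

lemma infinite_path_through:
  assumes "row_finite_no_sources \<Lambda>" and "\<alpha> \<in> paths \<Lambda>"
  obtains x where "x \<in> infinite_paths" "\<alpha> \<in> x"
  using assms infinite_path_exists[of "src \<Lambda> \<alpha>"] path_concat_infinite mem_path_concat src_closed by metis

end

section \<open>The infinite path representation\<close>

lemma poly_mapping_eq_sum_single:
  "p = (\<Sum>k\<in>Poly_Mapping.keys p. Poly_Mapping.single k (Poly_Mapping.lookup p k))"
proof (rule poly_mapping_eqI)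
  fix j
  have "Poly_Mapping.lookup (\<Sum>k\<in>Poly_Mapping.keys p. Poly_Mapping.single k (Poly_Mapping.lookup p k)) j
      = (\<Sum>k\<in>Poly_Mapping.keys p. if k = j then Poly_Mapping.lookup p j else 0)"
    by (auto simp: lookup_sum lookup_single when_def intro!: sum.cong)
  also have "\<dots> = Poly_Mapping.lookup p j"
    by (simp add: in_keys_iff)
  finally show "Poly_Mapping.lookup p j
      = Poly_Mapping.lookup (\<Sum>k\<in>Poly_Mapping.keys p. Poly_Mapping.single k (Poly_Mapping.lookup p k)) j"
    by simp
qed

context k_graph
begin

lemma path_drop_compose:
  assumes x: "x \<in> infinite_paths" and \<alpha>: "\<alpha> \<in> paths \<Lambda>" "\<beta> \<in> paths \<Lambda>" "src \<Lambda> \<alpha> = rng \<Lambda> \<beta>"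
  shows "path_drop (compose \<Lambda> \<alpha> \<beta>) x = path_drop \<beta> (path_drop \<alpha> x)"
proof (rule Set.set_eqI)
  fix \<gamma>
  show "\<gamma> \<in> path_drop (compose \<Lambda> \<alpha> \<beta>) x \<longleftrightarrow> \<gamma> \<in> path_drop \<beta> (path_drop \<alpha> x)"
    unfolding path_drop_def mem_Collect_eq
    by (cases "\<gamma> \<in> paths \<Lambda> \<and> src \<Lambda> \<beta> = rng \<Lambda> \<gamma>")
      (use \<alpha> in \<open>auto simp only: src_compose rng_compose compose_assoc compose_closed\<close>)
qed

lemma compose_mem_infinite_path:
  assumes x: "x \<in> infinite_paths" and \<alpha>: "\<alpha> \<in> paths \<Lambda>" "\<beta> \<in> paths \<Lambda>" "src \<Lambda> \<alpha> = rng \<Lambda> \<beta>"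
  shows "compose \<Lambda> \<alpha> \<beta> \<in> x \<longleftrightarrow> \<alpha> \<in> x \<and> \<beta> \<in> path_drop \<alpha> x"
  unfolding path_drop_def using \<alpha> infinite_pathD(2)[OF x prefix_compose[OF \<alpha>]] by blast

text \<open>Every symbol kills the values at sets that are not infinite paths. Hence the relators act as
  zero on all functions and not only on those supported on infinite paths.\<close>

definition symbol_op :: "('v, 'e) kp_symbol \<Rightarrow> ('e set \<Rightarrow> 'f::field) \<Rightarrow> 'e set \<Rightarrow> 'f" where
  "symbol_op a f x = (if x \<in> infinite_paths then
     (case a of
       Vertex v \<Rightarrow> if ident \<Lambda> v \<in> x then f x else 0
     | Path \<alpha> \<Rightarrow> if \<alpha> \<in> x then f (path_drop \<alpha> x) else 0
     | Ghost \<alpha> \<Rightarrow> if ident \<Lambda> (src \<Lambda> \<alpha>) \<in> x then f (path_concat \<alpha> x) else 0) else 0)"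

text \<open>\<open>foldr\<close> makes the first letter of a word the outermost operator, so that
  concatenation of words becomes composition of operators.\<close>

definition poly_op :: "(('v, 'e) kp_symbol list \<Rightarrow>\<^sub>0 'f::field) \<Rightarrow> ('e set \<Rightarrow> 'f) \<Rightarrow> 'e set \<Rightarrow> 'f" where
  "poly_op p f x = (\<Sum>w\<in>Poly_Mapping.keys p. Poly_Mapping.lookup p w * foldr symbol_op w f x)"

lemma poly_op_superset:
  assumes "finite A" "Poly_Mapping.keys p \<subseteq> A"
  shows "poly_op p f x = (\<Sum>w\<in>A. Poly_Mapping.lookup p w * foldr symbol_op w f x)"
  unfolding poly_op_def using assms by (intro sum.mono_neutral_left) (auto simp: in_keys_iff)

lemma poly_op_zero: "poly_op 0 f x = 0"
  by (simp add: poly_op_def)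

lemma poly_op_single: "poly_op (Poly_Mapping.single w c) f = (\<lambda>x. c * foldr symbol_op w f x)"
  by (simp add: poly_op_def fun_eq_iff)

lemma poly_op_add: "poly_op (p + q) f x = poly_op p f x + poly_op q f x"
proof -
  let ?A = "Poly_Mapping.keys p \<union> Poly_Mapping.keys q"
  have "Poly_Mapping.keys (p + q) \<subseteq> ?A"
    by (rule Poly_Mapping.keys_add)
  then show ?thesis
    by (subst (1 2 3) poly_op_superset[of ?A]) (auto simp: lookup_add distrib_right sum.distrib)
qed

lemma poly_op_uminus: "poly_op (- p) f x = - poly_op p f x"
  using poly_op_add[of p "- p" f x] by (simp add: poly_op_zero add_eq_0_iff)

lemma poly_op_diff: "poly_op (p - q) f x = poly_op p f x - poly_op q f x"
  using poly_op_add[of p "- q" f x] by (simp add: poly_op_uminus)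

lemma poly_op_smult: "poly_op (Poly_Mapping.map ((*) c) p) f x = c * poly_op p f x"
proof -
  have "Poly_Mapping.keys (Poly_Mapping.map ((*) c) p) \<subseteq> Poly_Mapping.keys p"
    by (auto simp: in_keys_iff map.rep_eq)
  then show ?thesis
    by (subst poly_op_superset[of "Poly_Mapping.keys p"])
      (auto simp: poly_op_def map.rep_eq sum_distrib_left when_def in_keys_iff mult.assoc intro!: sum.cong)
qed

lemma poly_op_sum: "poly_op (\<Sum>i\<in>A. p i) f x = (\<Sum>i\<in>A. poly_op (p i) f x)"
  by (induction A rule: infinite_finite_induct) (simp_all add: poly_op_zero poly_op_add)

lemma symbol_op_sum: "symbol_op a (\<lambda>y. \<Sum>i\<in>A. c i * g i y) x = (\<Sum>i\<in>A. c i * symbol_op a (g i) x)"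
  by (simp add: symbol_op_def split: kp_symbol.split)

lemma word_op_sum:
  "foldr symbol_op w (\<lambda>y. \<Sum>i\<in>A. c i * g i y) = (\<lambda>y. \<Sum>i\<in>A. c i * foldr symbol_op w (g i) y)"
proof (induction w)
  case (Cons a w)
  show ?case
    by (rule ext) (simp add: Cons symbol_op_sum)
qed simp

lemma word_op_zero: "foldr symbol_op w (\<lambda>_. 0) = (\<lambda>_. 0)"
  by (induction w) (simp_all add: symbol_op_def fun_eq_iff split: kp_symbol.split)

text \<open>By bilinearity it suffices to treat monomials, where multiplication concatenates words.
  \<open>word_op_sum\<close> is the linearity that pulls the inner sum out of the outer
  word.\<close>

lemma poly_op_mult: "poly_op (p * q) f = poly_op p (poly_op q f)"
proof
  fix x
  let ?P = "Poly_Mapping.lookup p" and ?Q = "Poly_Mapping.lookup q"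
  have "p * q = (\<Sum>u\<in>Poly_Mapping.keys p. Poly_Mapping.single u (?P u))
      * (\<Sum>w\<in>Poly_Mapping.keys q. Poly_Mapping.single w (?Q w))"
    by (metis poly_mapping_eq_sum_single)
  also have "\<dots> = (\<Sum>u\<in>Poly_Mapping.keys p. \<Sum>w\<in>Poly_Mapping.keys q.
      Poly_Mapping.single (u @ w) (?P u * ?Q w))"
    by (simp add: sum_product mult_single plus_list_def)
  finally have "poly_op (p * q) f x = (\<Sum>u\<in>Poly_Mapping.keys p. \<Sum>w\<in>Poly_Mapping.keys q.
      ?P u * ?Q w * foldr symbol_op u (foldr symbol_op w f) x)"
    by (simp add: poly_op_sum poly_op_single)
  also have "\<dots> = poly_op p (poly_op q f) x"
    by (simp add: poly_op_def[abs_def] word_op_sum sum_distrib_left mult.assoc)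
  finally show "poly_op (p * q) f x = poly_op p (poly_op q f) x" .
qed

section \<open>The Kumjian--Pask relations on functions of infinite paths\<close>

lemma nontrivial_pathsD: "\<alpha> \<in> nontrivial_paths \<Lambda> \<Longrightarrow> \<alpha> \<in> paths \<Lambda>"
  by (simp add: nontrivial_paths_def)

text \<open>The range projection acts as the indicator function of the cylinder set of \<alpha>,
  because dropping \<alpha> and putting it back changes nothing.\<close>

lemma symbol_op_path_ghost:
  assumes "\<alpha> \<in> paths \<Lambda>"
  shows "symbol_op (Path \<alpha>) (symbol_op (Ghost \<alpha>) f) x = (if x \<in> infinite_paths \<and> \<alpha> \<in> x then f x else 0)"
  using path_drop_infinite path_drop_ident path_concat_drop by (simp add: symbol_op_def)

lemma poly_op_KP1:
  "\<lbrakk>u \<in> verts \<Lambda>; v \<in> verts \<Lambda>\<rbrakk> \<Longrightarrow> poly_op (kp_p u * kp_p v - (if u = v then kp_p u else 0)) f x = 0"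
  using infinite_pathD(3)[of x "ident \<Lambda> u" "ident \<Lambda> v"]
  by (auto simp: poly_op_diff poly_op_mult poly_op_single poly_op_zero symbol_op_def deg_ident ident_inject)

lemma poly_op_KP2_path:
  assumes "\<alpha> \<in> paths \<Lambda>" "\<beta> \<in> paths \<Lambda>" "src \<Lambda> \<alpha> = rng \<Lambda> \<beta>"
  shows "poly_op (kp_s \<alpha> * kp_s \<beta> - kp_s (compose \<Lambda> \<alpha> \<beta>)) f x = 0"
  using assms
  by (simp add: poly_op_diff poly_op_mult poly_op_single symbol_op_def compose_mem_infinite_path
      path_drop_compose path_drop_infinite)

lemma poly_op_KP2_ghost:
  assumes "\<alpha> \<in> paths \<Lambda>" "\<beta> \<in> paths \<Lambda>" "src \<Lambda> \<alpha> = rng \<Lambda> \<beta>"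
  shows "poly_op (kp_t \<beta> * kp_t \<alpha> - kp_t (compose \<Lambda> \<alpha> \<beta>)) f x = 0"
proof -
  have "path_concat \<beta> x \<in> infinite_paths \<and> ident \<Lambda> (src \<Lambda> \<alpha>) \<in> path_concat \<beta> x"
    if "x \<in> infinite_paths" "ident \<Lambda> (src \<Lambda> \<beta>) \<in> x"
    using that assms path_concat_infinite mem_path_concat infinite_path_rng src_closed by metis
  then show ?thesis
    using assms
    by (simp add: poly_op_diff poly_op_mult poly_op_single symbol_op_def src_compose
        path_concat_compose)
qed

lemma poly_op_KP2_vertex:
  assumes \<alpha>: "\<alpha> \<in> paths \<Lambda>"
  shows "poly_op (kp_p (rng \<Lambda> \<alpha>) * kp_s \<alpha> - kp_s \<alpha>) f x = 0"
    and "poly_op (kp_s \<alpha> * kp_p (src \<Lambda> \<alpha>) - kp_s \<alpha>) f x = 0"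
    and "poly_op (kp_p (src \<Lambda> \<alpha>) * kp_t \<alpha> - kp_t \<alpha>) f x = 0"
    and "poly_op (kp_t \<alpha> * kp_p (rng \<Lambda> \<alpha>) - kp_t \<alpha>) f x = 0"
proof -
  have 1: "ident \<Lambda> (rng \<Lambda> \<alpha>) \<in> x" if "x \<in> infinite_paths" "\<alpha> \<in> x" for x
    using that infinite_path_rng[of x \<alpha>] rng_closed[OF \<alpha>] by blast
  note simps = poly_op_diff poly_op_mult poly_op_single symbol_op_def
  show "poly_op (kp_p (rng \<Lambda> \<alpha>) * kp_s \<alpha> - kp_s \<alpha>) f x = 0"
    using 1 by (simp add: simps)
  show "poly_op (kp_s \<alpha> * kp_p (src \<Lambda> \<alpha>) - kp_s \<alpha>) f x = 0"
    using path_drop_infinite path_drop_ident by (simp add: simps)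
  show "poly_op (kp_p (src \<Lambda> \<alpha>) * kp_t \<alpha> - kp_t \<alpha>) f x = 0"
    by (simp add: simps)
  show "poly_op (kp_t \<alpha> * kp_p (rng \<Lambda> \<alpha>) - kp_t \<alpha>) f x = 0"
    using 1 path_concat_infinite mem_path_concat \<alpha> by (simp add: simps)
qed

text \<open>The infinite path \<alpha>x has a single initial segment of degree d(\<alpha>), namely
  \<alpha>. So a different \<beta> of this degree contributes 0, and \<beta> = \<alpha> gives back
  x.\<close>

lemma poly_op_KP3:
  assumes "\<alpha> \<in> paths \<Lambda>" "\<beta> \<in> paths \<Lambda>" "deg \<Lambda> \<alpha> = deg \<Lambda> \<beta>"
  shows "poly_op (kp_t \<alpha> * kp_s \<beta> - (if \<alpha> = \<beta> then kp_p (src \<Lambda> \<alpha>) else 0)) f x = 0"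
  using assms path_concat_infinite[of x \<alpha>] mem_path_concat[of x \<alpha>] path_drop_concat[of x \<alpha>]
    infinite_pathD(3)[of "path_concat \<alpha> x" \<alpha> \<beta>]
  by (auto simp: poly_op_diff poly_op_mult poly_op_single poly_op_zero symbol_op_def)

text \<open>The cylinder sets of the paths of degree \<open>n\<close> with range \<open>v\<close>
  partition the infinite paths starting at \<open>v\<close>, so their indicator functions add up to
  that of \<open>v\<close>.\<close>

lemma poly_op_KP4:
  assumes "row_finite_no_sources \<Lambda>" and v: "v \<in> verts \<Lambda>"
  shows "poly_op (kp_p v - (\<Sum>\<alpha>\<in>paths_from \<Lambda> v n. kp_s \<alpha> * kp_t \<alpha>)) f x = 0"
proof -
  have fin: "finite (paths_from \<Lambda> v n)"
    using assms by (simp add: row_finite_no_sources_def)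
  have "poly_op (\<Sum>\<alpha>\<in>paths_from \<Lambda> v n. kp_s \<alpha> * kp_t \<alpha>) f x
      = (\<Sum>\<alpha>\<in>paths_from \<Lambda> v n. symbol_op (Path \<alpha>) (symbol_op (Ghost \<alpha>) f) x)"
    by (simp add: poly_op_sum poly_op_mult poly_op_single)
  also have "\<dots> = (\<Sum>\<alpha>\<in>paths_from \<Lambda> v n. if x \<in> infinite_paths \<and> \<alpha> \<in> x then f x else 0)"
    by (intro sum.cong) (auto simp: symbol_op_path_ghost paths_from_def)
  also have "\<dots> = (if x \<in> infinite_paths \<and> ident \<Lambda> v \<in> x then f x else 0)"
  proof (cases "x \<in> infinite_paths \<and> ident \<Lambda> v \<in> x")
    case True
    then obtain \<alpha> where \<alpha>: "\<alpha> \<in> x" "deg \<Lambda> \<alpha> = n"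
      using infinite_pathD(4) by blast
    with True v have "\<alpha> \<in> paths_from \<Lambda> v n"
      using infinite_pathD(1) infinite_path_rng by (auto simp: paths_from_def)
    moreover have "\<beta> \<in> x \<longleftrightarrow> \<beta> = \<alpha>" if "\<beta> \<in> paths_from \<Lambda> v n" for \<beta>
      using that True \<alpha> infinite_pathD(3) by (auto simp: paths_from_def)
    ultimately show ?thesis
      using True fin by (simp cong: sum.cong)
  next
    case False
    have "\<not> (x \<in> infinite_paths \<and> \<alpha> \<in> x)" if "\<alpha> \<in> paths_from \<Lambda> v n" for \<alpha>
      using that False v infinite_path_rng by (auto simp: paths_from_def)
    then show ?thesis
      using False by (auto intro!: sum.neutral)
  qed
  finally show ?thesis
    by (simp add: poly_op_diff poly_op_single symbol_op_def)
qed

lemma poly_op_relator: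
  assumes "row_finite_no_sources \<Lambda>" "p \<in> kp_relators \<Lambda>"
  shows "poly_op p f x = 0"
  using assms(2)
proof cases
  case (KP1 u v)
  then show ?thesis by (simp only: poly_op_KP1)
next
  case (KP2_path \<alpha> \<beta>)
  then show ?thesis by (simp only: poly_op_KP2_path nontrivial_pathsD)
next
  case (KP2_ghost \<alpha> \<beta>)
  then show ?thesis by (simp only: poly_op_KP2_ghost nontrivial_pathsD)
next
  case (KP3 \<alpha> \<beta>)
  then show ?thesis by (simp only: poly_op_KP3 nontrivial_pathsD)
next
  case (KP4 v n)
  then show ?thesis by (simp only: poly_op_KP4[OF assms(1)])
qed (simp_all only: poly_op_KP2_vertex nontrivial_pathsD)

text \<open>The induction keeps \<open>f\<close> arbitrary: for a product \<open>p * a\<close> the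
  hypothesis is applied to the function \<open>poly_op a f\<close>, and for \<open>a * p\<close> it
  makes \<open>poly_op p f\<close> the zero function.\<close>

lemma poly_op_ideal:
  assumes "row_finite_no_sources \<Lambda>"
    and "p \<in> ideal_generated (free_algebra (kp_symbols \<Lambda>)) (kp_relators \<Lambda>)"
  shows "poly_op p f x = 0"
  using assms(2)
proof (induction arbitrary: f x)
  case (incl p)
  then show ?case by (rule poly_op_relator[OF assms(1)])
next
  case (left a p)
  have "poly_op p f = (\<lambda>_. 0)"
    using left.IH by blast
  then show ?case
    by (simp add: free_algebra_def poly_op_mult) (simp add: poly_op_def word_op_zero)
qed (simp_all add: free_algebra_def poly_op_zero poly_op_add poly_op_smult poly_op_mult)

end

section \<open>Computations in the Kumjian--Pask algebra\<close>

context k_graph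
begin

abbreviation kp_free :: "('f::field, ('v, 'e) kp_symbol list \<Rightarrow>\<^sub>0 'f) module" where
  "kp_free \<equiv> free_algebra (kp_symbols \<Lambda>)"

definition kp_ideal :: "(('v, 'e) kp_symbol list \<Rightarrow>\<^sub>0 'f::field) set" where
  "kp_ideal = ideal_generated kp_free (kp_relators \<Lambda>)"

text \<open>Computations take place on representatives modulo the ideal;
  \<open>kp_class_eq_iff\<close> and \<open>kp_class_mult\<close> transfer the results to the
  quotient.\<close>

definition kp_cong :: "(('v, 'e) kp_symbol list \<Rightarrow>\<^sub>0 'f::field) \<Rightarrow> (('v, 'e) kp_symbol list \<Rightarrow>\<^sub>0 'f) \<Rightarrow> bool"
    (infix \<open>\<approx>\<close> 50) where
  "p \<approx> q \<longleftrightarrow> p - q \<in> kp_ideal"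

definition kp_class :: "(('v, 'e) kp_symbol list \<Rightarrow>\<^sub>0 'f::field) \<Rightarrow> (('v, 'e) kp_symbol list \<Rightarrow>\<^sub>0 'f) set" where
  "kp_class p = kp_ideal +>\<^bsub>kp_free\<^esub> p"

lemma kp_free_carrier_iff: "p \<in> carrier kp_free \<longleftrightarrow> Poly_Mapping.keys p \<subseteq> lists (kp_symbols \<Lambda>) - {[]}"
  by (simp add: free_algebra_def)

lemma kp_free_zero: "0 \<in> carrier kp_free"
  by (simp add: kp_free_carrier_iff)

lemma kp_free_add: "p \<in> carrier kp_free \<Longrightarrow> q \<in> carrier kp_free \<Longrightarrow> p + q \<in> carrier kp_free"
  unfolding kp_free_carrier_iff using Poly_Mapping.keys_add[of p q] by blast

lemma kp_free_diff: "p \<in> carrier kp_free \<Longrightarrow> q \<in> carrier kp_free \<Longrightarrow> p - q \<in> carrier kp_free"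
  unfolding kp_free_carrier_iff using Poly_Mapping.keys_diff[of p q] by blast

lemma kp_free_mult: "p \<in> carrier kp_free \<Longrightarrow> q \<in> carrier kp_free \<Longrightarrow> p * q \<in> carrier kp_free"
  unfolding kp_free_carrier_iff using Poly_Mapping.keys_mult[of p q] by (fastforce simp: plus_list_def)

lemma kp_free_sum: "(\<And>i. i \<in> A \<Longrightarrow> p i \<in> carrier kp_free) \<Longrightarrow> (\<Sum>i\<in>A. p i) \<in> carrier kp_free"
  by (induction A rule: infinite_finite_induct) (auto intro: kp_free_zero kp_free_add)

lemma kp_free_smult: "p \<in> carrier kp_free \<Longrightarrow> Poly_Mapping.map ((*) c) p \<in> carrier kp_free"
  unfolding kp_free_carrier_iff by (auto simp: in_keys_iff map.rep_eq when_def split: if_splits)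

lemma kp_free_symbols:
  "v \<in> verts \<Lambda> \<Longrightarrow> kp_p v \<in> carrier kp_free"
  "\<alpha> \<in> nontrivial_paths \<Lambda> \<Longrightarrow> kp_s \<alpha> \<in> carrier kp_free"
  "\<alpha> \<in> nontrivial_paths \<Lambda> \<Longrightarrow> kp_t \<alpha> \<in> carrier kp_free"
  unfolding kp_free_carrier_iff by (auto simp: kp_symbols_def)

text \<open>This keeps the ideal inside the free algebra without unit. Composites of nontrivial
  paths are nontrivial, and \<open>n \<noteq> 0\<close> excludes identities in KP4, so only
  admissible symbols occur.\<close>

lemma kp_relators_closed:
  assumes "p \<in> kp_relators \<Lambda>"
  shows "p \<in> carrier kp_free"
proof -
  have nt: "compose \<Lambda> \<alpha> \<beta> \<in> nontrivial_paths \<Lambda>"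
    if "\<alpha> \<in> nontrivial_paths \<Lambda>" "\<beta> \<in> nontrivial_paths \<Lambda>" "src \<Lambda> \<alpha> = rng \<Lambda> \<beta>" for \<alpha> \<beta>
    using that by (auto simp: nontrivial_paths_def compose_closed deg_compose fun_eq_iff)
  have KP4: "kp_s \<alpha> * kp_t \<alpha> \<in> carrier kp_free" if "\<alpha> \<in> paths_from \<Lambda> v n" "n \<noteq> 0" for \<alpha> v n
    using that by (intro kp_free_mult kp_free_symbols) (auto simp: paths_from_def nontrivial_paths_def)
  show ?thesis
    using assms
    by cases (auto simp del: mult_single intro!: kp_free_diff kp_free_mult kp_free_symbols kp_free_sum KP4 nt kp_free_zero
        src_closed rng_closed dest: nontrivial_pathsD)
qed

lemma kp_ideal_closed: "p \<in> kp_ideal \<Longrightarrow> p \<in> carrier kp_free"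
  unfolding kp_ideal_def
proof (induction rule: ideal_generated.induct)
  case (incl p)
  then show ?case by (rule kp_relators_closed)
next
  case (add p q)
  then show ?case using kp_free_add[of p q] by (simp add: free_algebra_def)
next
  case (smult p c)
  then show ?case using kp_free_smult[of p c] by (simp add: free_algebra_def)
next
  case (left a p)
  then show ?case using kp_free_mult[of a p] by (simp add: free_algebra_def)
next
  case (right a p)
  then show ?case using kp_free_mult[of p a] by (simp add: free_algebra_def)
qed (simp add: free_algebra_def)

lemma kp_ideal_zero: "0 \<in> kp_ideal"
  using ideal_generated.zero[of kp_free "kp_relators \<Lambda>"] by (simp add: kp_ideal_def free_algebra_def)

lemma kp_ideal_add: "p \<in> kp_ideal \<Longrightarrow> q \<in> kp_ideal \<Longrightarrow> p + q \<in> kp_ideal"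
  using ideal_generated.add[of p kp_free "kp_relators \<Lambda>" q] by (simp add: kp_ideal_def free_algebra_def)

lemma kp_ideal_uminus: "p \<in> kp_ideal \<Longrightarrow> - p \<in> kp_ideal"
proof -
  have "Poly_Mapping.map ((*) (- 1)) p = - p"
    by (rule poly_mapping_eqI) (simp add: map.rep_eq when_def)
  then show "p \<in> kp_ideal \<Longrightarrow> - p \<in> kp_ideal"
    using ideal_generated.smult[of p kp_free "kp_relators \<Lambda>" "- 1"]
    by (simp add: kp_ideal_def free_algebra_def)
qed

lemma kp_ideal_mult_left: "a \<in> carrier kp_free \<Longrightarrow> p \<in> kp_ideal \<Longrightarrow> a * p \<in> kp_ideal"
  using ideal_generated.left[of a kp_free p "kp_relators \<Lambda>"] by (simp add: kp_ideal_def free_algebra_def)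

lemma kp_ideal_mult_right: "a \<in> carrier kp_free \<Longrightarrow> p \<in> kp_ideal \<Longrightarrow> p * a \<in> kp_ideal"
  using ideal_generated.right[of a kp_free p "kp_relators \<Lambda>"] by (simp add: kp_ideal_def free_algebra_def)

lemma kp_cong_relator: "p - q \<in> kp_relators \<Lambda> \<Longrightarrow> p \<approx> q"
  unfolding kp_cong_def kp_ideal_def by (rule ideal_generated.incl)

lemma kp_cong_refl: "p \<approx> p"
  by (simp add: kp_cong_def kp_ideal_zero)

lemma kp_cong_sym: "p \<approx> q \<Longrightarrow> q \<approx> p"
  using kp_ideal_uminus[of "p - q"] by (simp add: kp_cong_def)

lemma kp_cong_trans [trans]: "p \<approx> q \<Longrightarrow> q \<approx> r \<Longrightarrow> p \<approx> r"
  using kp_ideal_add[of "p - q" "q - r"] by (simp add: kp_cong_def)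

lemma kp_cong_add: "p \<approx> q \<Longrightarrow> p' \<approx> q' \<Longrightarrow> p + p' \<approx> q + q'"
  using kp_ideal_add[of "p - q" "p' - q'"] by (simp add: kp_cong_def algebra_simps)

lemma kp_cong_sum: "(\<And>i. i \<in> A \<Longrightarrow> p i \<approx> q i) \<Longrightarrow> (\<Sum>i\<in>A. p i) \<approx> (\<Sum>i\<in>A. q i)"
  by (induction A rule: infinite_finite_induct) (auto intro: kp_cong_refl kp_cong_add)

lemma kp_cong_mult_left: "a \<in> carrier kp_free \<Longrightarrow> p \<approx> q \<Longrightarrow> a * p \<approx> a * q"
  using kp_ideal_mult_left[of a "p - q"] by (simp add: kp_cong_def right_diff_distrib)

lemma kp_cong_mult_right: "a \<in> carrier kp_free \<Longrightarrow> p \<approx> q \<Longrightarrow> p * a \<approx> q * a"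
  using kp_ideal_mult_right[of a "p - q"] by (simp add: kp_cong_def left_diff_distrib)

lemma kp_class_altdef: "kp_class p = {q. q \<approx> p}"
proof -
  have "kp_class p = (\<lambda>h. h + p) ` kp_ideal"
    by (auto simp: kp_class_def a_r_coset_def r_coset_def free_algebra_def)
  also have "\<dots> = {q. q \<approx> p}"
    by (force simp: kp_cong_def)
  finally show ?thesis .
qed

lemma kp_class_eq_iff: "kp_class p = kp_class q \<longleftrightarrow> p \<approx> q"
  unfolding kp_class_altdef using kp_cong_refl kp_cong_sym kp_cong_trans by blast

lemma kp_cong_closed: "p \<approx> q \<Longrightarrow> q \<in> carrier kp_free \<Longrightarrow> p \<in> carrier kp_free"
  using kp_free_add[OF kp_ideal_closed, of "p - q" q] by (simp add: kp_cong_def)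

lemma kp_class_closed: "p \<in> carrier kp_free \<Longrightarrow> kp_class p \<in> carrier (kp_algebra \<Lambda>)"
  by (auto simp: kp_algebra_def quotient_algebra_def A_RCOSETS_def RCOSETS_def a_r_coset_def
      kp_class_def kp_ideal_def)

text \<open>Cosets are multiplied by a union over representatives. Replacing \<open>b\<close> by
  \<open>q\<close> and then \<open>a\<close> by \<open>p\<close> stays in one class; the first
  replacement multiplies by \<open>a\<close>, which lies in the carrier by
  \<open>kp_cong_closed\<close>.\<close>

lemma kp_class_mult:
  assumes p: "p \<in> carrier kp_free" and q: "q \<in> carrier kp_free"
  shows "kp_class p \<otimes>\<^bsub>kp_algebra \<Lambda>\<^esub> kp_class q = kp_class (p * q)"
proof -
  have "kp_class (a * b) = kp_class (p * q)" if "a \<approx> p" "b \<approx> q" for a b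
    unfolding kp_class_eq_iff
    using kp_cong_trans[OF kp_cong_mult_left[OF kp_cong_closed[OF that(1) p] that(2)]
        kp_cong_mult_right[OF q that(1)]] .
  then have "(\<Union>a\<in>kp_class p. \<Union>b\<in>kp_class q. kp_class (a * b)) = kp_class (p * q)"
    using kp_cong_refl[of p] kp_cong_refl[of q] unfolding kp_class_altdef[of p] kp_class_altdef[of q] by blast
  then show ?thesis
    by (simp add: kp_algebra_def quotient_algebra_def rcoset_mult_def kp_class_def kp_ideal_def)
      (simp add: free_algebra_def)
qed

section \<open>Generators for all paths and their range projections\<close>

text \<open>\<open>s\<^sub>\<alpha>\<close> and \<open>s\<^sub>\<alpha>\<^sub>*\<close> for all paths, with \<open>s\<^sub>v = s\<^sub>v\<^sub>* = p\<^sub>v\<close> for the vertices.\<close>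

definition kp_path :: "'e \<Rightarrow> ('v, 'e) kp_symbol list \<Rightarrow>\<^sub>0 'f::field" where
  "kp_path \<alpha> = (if deg \<Lambda> \<alpha> = 0 then kp_p (rng \<Lambda> \<alpha>) else kp_s \<alpha>)"

definition kp_ghost :: "'e \<Rightarrow> ('v, 'e) kp_symbol list \<Rightarrow>\<^sub>0 'f::field" where
  "kp_ghost \<alpha> = (if deg \<Lambda> \<alpha> = 0 then kp_p (rng \<Lambda> \<alpha>) else kp_t \<alpha>)"

lemma kp_path_closed: "\<alpha> \<in> paths \<Lambda> \<Longrightarrow> kp_path \<alpha> \<in> carrier kp_free"
  by (auto simp: kp_path_def nontrivial_paths_def rng_closed intro!: kp_free_symbols)

lemma kp_ghost_closed: "\<alpha> \<in> paths \<Lambda> \<Longrightarrow> kp_ghost \<alpha> \<in> carrier kp_free"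
  by (auto simp: kp_ghost_def nontrivial_paths_def rng_closed intro!: kp_free_symbols)

lemma kp_vertex_idem: "v \<in> verts \<Lambda> \<Longrightarrow> kp_p v * kp_p v \<approx> kp_p v"
  using kp_relators.KP1[of v \<Lambda> v] by (intro kp_cong_relator) (simp del: mult_single)

lemma trivial_path_cases:
  assumes "\<alpha> \<in> paths \<Lambda>"
  obtains (trivial) v where "v \<in> verts \<Lambda>" "\<alpha> = ident \<Lambda> v"
    | (nontrivial) "\<alpha> \<in> nontrivial_paths \<Lambda>" "deg \<Lambda> \<alpha> \<noteq> 0"
  using assms deg_zero_ident[of \<alpha>] rng_closed[of \<alpha>] by (auto simp: nontrivial_paths_def)

lemma kp_path_ident [simp]: "v \<in> verts \<Lambda> \<Longrightarrow> kp_path (ident \<Lambda> v) = kp_p v"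
  by (simp add: kp_path_def deg_ident rng_ident)

lemma kp_ghost_ident [simp]: "v \<in> verts \<Lambda> \<Longrightarrow> kp_ghost (ident \<Lambda> v) = kp_p v"
  by (simp add: kp_ghost_def deg_ident rng_ident)

lemma kp_vertex_path:
  assumes \<alpha>: "\<alpha> \<in> paths \<Lambda>"
  shows "kp_p (rng \<Lambda> \<alpha>) * kp_path \<alpha> \<approx> kp_path \<alpha>" "kp_path \<alpha> * kp_p (src \<Lambda> \<alpha>) \<approx> kp_path \<alpha>"
    "kp_p (src \<Lambda> \<alpha>) * kp_ghost \<alpha> \<approx> kp_ghost \<alpha>" "kp_ghost \<alpha> * kp_p (rng \<Lambda> \<alpha>) \<approx> kp_ghost \<alpha>"
  using \<alpha>
  by (cases rule: trivial_path_cases;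
      auto simp del: mult_single simp: rng_ident src_ident kp_path_def[of \<alpha>] kp_ghost_def[of \<alpha>] deg_ident
        intro: kp_vertex_idem kp_relators.intros kp_cong_relator)+

lemma kp_path_mult:
  assumes "\<alpha> \<in> paths \<Lambda>" "\<beta> \<in> paths \<Lambda>" "src \<Lambda> \<alpha> = rng \<Lambda> \<beta>"
  shows "kp_path \<alpha> * kp_path \<beta> \<approx> kp_path (compose \<Lambda> \<alpha> \<beta>)"
  using assms(1)
proof (cases rule: trivial_path_cases)
  case (trivial v)
  then show ?thesis
    using assms kp_vertex_path(1)[of \<beta>] by (simp add: src_ident ident_left)
next
  case \<alpha>: nontrivial
  show ?thesis
    using assms(2)
  proof (cases rule: trivial_path_cases)
    case (trivial v)
    then show ?thesis
      using assms kp_vertex_path(2)[of \<alpha>] ident_right[of \<alpha>] by (simp add: rng_ident)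
  next
    case nontrivial
    have "deg \<Lambda> (compose \<Lambda> \<alpha> \<beta>) \<noteq> 0"
      using assms \<alpha>(2) by (auto simp: deg_compose fun_eq_iff)
    then show ?thesis
      using kp_relators.KP2_path[OF \<alpha>(1) nontrivial(1) assms(3)] nontrivial \<alpha>
      by (intro kp_cong_relator) (simp add: kp_path_def)
  qed
qed

lemma kp_ghost_mult:
  assumes "\<alpha> \<in> paths \<Lambda>" "\<beta> \<in> paths \<Lambda>" "src \<Lambda> \<alpha> = rng \<Lambda> \<beta>"
  shows "kp_ghost \<beta> * kp_ghost \<alpha> \<approx> kp_ghost (compose \<Lambda> \<alpha> \<beta>)"
  using assms(1)
proof (cases rule: trivial_path_cases)
  case (trivial v)
  then show ?thesis
    using assms kp_vertex_path(4)[of \<beta>] by (simp add: src_ident ident_left)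
next
  case \<alpha>: nontrivial
  show ?thesis
    using assms(2)
  proof (cases rule: trivial_path_cases)
    case (trivial v)
    then show ?thesis
      using assms kp_vertex_path(3)[of \<alpha>] ident_right[of \<alpha>] by (simp add: rng_ident)
  next
    case nontrivial
    have "deg \<Lambda> (compose \<Lambda> \<alpha> \<beta>) \<noteq> 0"
      using assms \<alpha>(2) by (auto simp: deg_compose fun_eq_iff)
    then show ?thesis
      using kp_relators.KP2_ghost[OF \<alpha>(1) nontrivial(1) assms(3)] nontrivial \<alpha>
      by (intro kp_cong_relator) (simp add: kp_ghost_def)
  qed
qed

lemma kp_ghost_path:
  assumes "\<alpha> \<in> paths \<Lambda>"
  shows "kp_ghost \<alpha> * kp_path \<alpha> \<approx> kp_p (src \<Lambda> \<alpha>)"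
  using assms
proof (cases rule: trivial_path_cases)
  case (trivial v)
  then show ?thesis
    using kp_vertex_idem by (simp del: mult_single add: src_ident)
next
  case nontrivial
  then show ?thesis
    using kp_relators.KP3[OF nontrivial(1) nontrivial(1)]
    by (intro kp_cong_relator) (simp del: mult_single add: kp_path_def kp_ghost_def)
qed

text \<open>KP4 extended to degree 0, where the sum has the single term
  \<open>kp_p v * kp_p v\<close>. This degree occurs below when d(\<nu>) \<le> d(\<mu>).\<close>

lemma kp_vertex_sum:
  assumes v: "v \<in> verts \<Lambda>"
  shows "kp_p v \<approx> (\<Sum>\<alpha>\<in>paths_from \<Lambda> v n. kp_path \<alpha> * kp_ghost \<alpha>)" (is "_ \<approx> ?S")
proof (cases "n = 0")
  case True
  then show ?thesis
    using kp_cong_sym[OF kp_vertex_idem[OF v]] v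
    by (simp del: mult_single add: paths_from_zero)
next
  case False
  have "?S = (\<Sum>\<alpha>\<in>paths_from \<Lambda> v n. kp_s \<alpha> * kp_t \<alpha>)"
    using False by (intro sum.cong) (auto simp: paths_from_def kp_path_def kp_ghost_def)
  then show ?thesis
    using kp_relators.KP4[OF v False] by (intro kp_cong_relator) (simp only:)
qed

lemma kp_path_ghost_path:
  assumes "\<alpha> \<in> paths \<Lambda>"
  shows "kp_path \<alpha> * (kp_ghost \<alpha> * kp_path \<alpha>) \<approx> kp_path \<alpha>"
  using kp_cong_mult_left[OF kp_path_closed[OF assms] kp_ghost_path[OF assms]] kp_vertex_path(2)[OF assms]
  by (rule kp_cong_trans)

lemma kp_ghost_path_ghost:
  assumes "\<alpha> \<in> paths \<Lambda>"
  shows "(kp_ghost \<alpha> * kp_path \<alpha>) * kp_ghost \<alpha> \<approx> kp_ghost \<alpha>"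
  using kp_cong_mult_right[OF kp_ghost_closed[OF assms] kp_ghost_path[OF assms]] kp_vertex_path(3)[OF assms]
  by (rule kp_cong_trans)

text \<open>Writing \<gamma> = \<alpha>\<beta> brings \<open>kp_ghost \<alpha>\<close> next to
  \<open>kp_path \<alpha>\<close>, and this pair collapses to the vertex s(\<alpha>).\<close>

lemma kp_range_mult_path:
  assumes "prefix \<alpha> \<gamma>"
  shows "kp_path \<alpha> * kp_ghost \<alpha> * kp_path \<gamma> \<approx> kp_path \<gamma>"
proof -
  obtain \<beta> where \<beta>: "\<alpha> \<in> paths \<Lambda>" "\<beta> \<in> paths \<Lambda>" "src \<Lambda> \<alpha> = rng \<Lambda> \<beta>" "\<gamma> = compose \<Lambda> \<alpha> \<beta>"
    using assms by (rule prefixE)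
  have \<gamma>: "kp_path \<gamma> \<approx> kp_path \<alpha> * kp_path \<beta>"
    using kp_path_mult[OF \<beta>(1-3)] \<beta>(4) kp_cong_sym by blast
  have "kp_path \<alpha> * kp_ghost \<alpha> * kp_path \<gamma> \<approx> kp_path \<alpha> * kp_ghost \<alpha> * (kp_path \<alpha> * kp_path \<beta>)"
    using \<beta> \<gamma> by (intro kp_cong_mult_left kp_free_mult kp_path_closed kp_ghost_closed)
  also have "\<dots> = (kp_path \<alpha> * (kp_ghost \<alpha> * kp_path \<alpha>)) * kp_path \<beta>"
    by (simp only: mult.assoc)
  also have "\<dots> \<approx> kp_path \<alpha> * kp_path \<beta>"
    using \<beta> by (intro kp_cong_mult_right kp_path_closed kp_path_ghost_path)
  also have "\<dots> \<approx> kp_path \<gamma>"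
    using \<gamma> by (rule kp_cong_sym)
  finally show ?thesis .
qed

lemma kp_ghost_mult_range:
  assumes "prefix \<alpha> \<gamma>"
  shows "kp_ghost \<gamma> * (kp_path \<alpha> * kp_ghost \<alpha>) \<approx> kp_ghost \<gamma>"
proof -
  obtain \<beta> where \<beta>: "\<alpha> \<in> paths \<Lambda>" "\<beta> \<in> paths \<Lambda>" "src \<Lambda> \<alpha> = rng \<Lambda> \<beta>" "\<gamma> = compose \<Lambda> \<alpha> \<beta>"
    using assms by (rule prefixE)
  have \<gamma>: "kp_ghost \<gamma> \<approx> kp_ghost \<beta> * kp_ghost \<alpha>"
    using kp_ghost_mult[OF \<beta>(1-3)] \<beta>(4) kp_cong_sym by blast
  have "kp_ghost \<gamma> * (kp_path \<alpha> * kp_ghost \<alpha>) \<approx> kp_ghost \<beta> * kp_ghost \<alpha> * (kp_path \<alpha> * kp_ghost \<alpha>)"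
    using \<beta> \<gamma> by (intro kp_cong_mult_right kp_free_mult kp_path_closed kp_ghost_closed)
  also have "\<dots> = kp_ghost \<beta> * ((kp_ghost \<alpha> * kp_path \<alpha>) * kp_ghost \<alpha>)"
    by (simp only: mult.assoc)
  also have "\<dots> \<approx> kp_ghost \<beta> * kp_ghost \<alpha>"
    using \<beta> by (intro kp_cong_mult_left kp_ghost_closed kp_ghost_path_ghost)
  also have "\<dots> \<approx> kp_ghost \<gamma>"
    using \<gamma> by (rule kp_cong_sym)
  finally show ?thesis .
qed

text \<open>If all extensions of \<open>\<mu>\<close> by paths of a fixed degree extend \<open>\<nu>\<close>, then
  \<open>s\<^sub>\<mu> s\<^sub>\<mu>\<^sub>*\<close> lies below \<open>s\<^sub>\<nu> s\<^sub>\<nu>\<^sub>*\<close>.\<close>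

lemma kp_range_absorb:
  assumes \<mu>: "\<mu> \<in> paths \<Lambda>" and \<nu>: "\<nu> \<in> paths \<Lambda>"
    and ext: "\<And>\<tau>. \<tau> \<in> paths_from \<Lambda> (src \<Lambda> \<mu>) n \<Longrightarrow> prefix \<nu> (compose \<Lambda> \<mu> \<tau>)"
  shows "kp_path \<nu> * kp_ghost \<nu> * kp_path \<mu> \<approx>
      (kp_path \<mu> :: ('v, 'e) kp_symbol list \<Rightarrow>\<^sub>0 'f::field)" (is "?f * ?S \<approx> _")
    and "kp_ghost \<mu> * (kp_path \<nu> * kp_ghost \<nu>) \<approx>
      (kp_ghost \<mu> :: ('v, 'e) kp_symbol list \<Rightarrow>\<^sub>0 'f)" (is "?T * _ \<approx> _")
proof -
  let ?A = "paths_from \<Lambda> (src \<Lambda> \<mu>) n"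
  have A: "\<tau> \<in> paths \<Lambda>" "src \<Lambda> \<mu> = rng \<Lambda> \<tau>" if "\<tau> \<in> ?A" for \<tau>
    using that by (auto simp: paths_from_def)
  note closed = kp_free_mult kp_path_closed kp_ghost_closed
  have f: "?f \<in> carrier kp_free"
    using \<nu> by (intro closed)
  \<comment> \<open>Inserting the vertex sum at s(\<mu>) writes \<open>kp_path \<mu>\<close> as a
    sum of terms that begin with some \<mu>\<tau>. Each \<mu>\<tau> extends \<nu>, so
    \<open>?f\<close> fixes every term.\<close>
  have "?S \<approx> ?S * kp_p (src \<Lambda> \<mu>)"
    using kp_vertex_path(2)[OF \<mu>] by (rule kp_cong_sym)
  also have "\<dots> \<approx> ?S * (\<Sum>\<tau>\<in>?A. kp_path \<tau> * kp_ghost \<tau>)"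
    using \<mu> by (intro kp_cong_mult_left kp_path_closed kp_vertex_sum src_closed)
  also have "\<dots> = (\<Sum>\<tau>\<in>?A. ?S * kp_path \<tau> * kp_ghost \<tau>)"
    by (simp only: sum_distrib_left mult.assoc)
  also have "\<dots> \<approx> (\<Sum>\<tau>\<in>?A. kp_path (compose \<Lambda> \<mu> \<tau>) * kp_ghost \<tau>)" (is "_ \<approx> ?X")
    using A \<mu> by (intro kp_cong_sum kp_cong_mult_right kp_path_mult closed)
  finally have S: "?S \<approx> ?X" .
  have "?f * ?S \<approx> ?f * ?X"
    using f S by (rule kp_cong_mult_left)
  also have "\<dots> = (\<Sum>\<tau>\<in>?A. (?f * kp_path (compose \<Lambda> \<mu> \<tau>)) * kp_ghost \<tau>)"
    by (simp only: sum_distrib_left mult.assoc)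
  also have "\<dots> \<approx> ?X"
    using A ext by (intro kp_cong_sum kp_cong_mult_right kp_range_mult_path closed)
  also have "\<dots> \<approx> ?S"
    using S by (rule kp_cong_sym)
  finally show "?f * ?S \<approx> ?S" .
  \<comment> \<open>The mirror image, with ghosts for paths and the factors in reverse
    order.\<close>
  have "?T \<approx> kp_p (src \<Lambda> \<mu>) * ?T"
    using kp_vertex_path(3)[OF \<mu>] by (rule kp_cong_sym)
  also have "\<dots> \<approx> (\<Sum>\<tau>\<in>?A. kp_path \<tau> * kp_ghost \<tau>) * ?T"
    using \<mu> by (intro kp_cong_mult_right kp_ghost_closed kp_vertex_sum src_closed)
  also have "\<dots> = (\<Sum>\<tau>\<in>?A. kp_path \<tau> * (kp_ghost \<tau> * ?T))"
    by (simp only: sum_distrib_right mult.assoc)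
  also have "\<dots> \<approx> (\<Sum>\<tau>\<in>?A. kp_path \<tau> * kp_ghost (compose \<Lambda> \<mu> \<tau>))" (is "_ \<approx> ?Y")
    using A \<mu> by (intro kp_cong_sum kp_cong_mult_left kp_ghost_mult closed)
  finally have T: "?T \<approx> ?Y" .
  have "?T * ?f \<approx> ?Y * ?f"
    using f T by (rule kp_cong_mult_right)
  also have "\<dots> = (\<Sum>\<tau>\<in>?A. kp_path \<tau> * (kp_ghost (compose \<Lambda> \<mu> \<tau>) * ?f))"
    by (simp only: sum_distrib_right mult.assoc)
  also have "\<dots> \<approx> ?Y"
    using A ext by (intro kp_cong_sum kp_cong_mult_left kp_ghost_mult_range closed)
  also have "\<dots> \<approx> ?T"
    using T by (rule kp_cong_sym)
  finally show "?T * ?f \<approx> ?T" .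
qed

text \<open>In a generalized cycle, \<open>s\<^sub>\<mu> s\<^sub>\<nu>\<^sub>*\<close> and \<open>s\<^sub>\<nu> s\<^sub>\<mu>\<^sub>*\<close> are one-sided
  inverses in the corner of \<open>s\<^sub>\<nu> s\<^sub>\<nu>\<^sub>*\<close>.\<close>

lemma kp_range_eq:
  assumes cycle: "generalized_cycle \<Lambda> \<mu> \<nu>"
    and fin: "corner_finite (kp_algebra \<Lambda> :: ('f::field, (('v, 'e) kp_symbol list \<Rightarrow>\<^sub>0 'f) set) module)"
  shows "kp_path \<mu> * kp_ghost \<mu> \<approx> (kp_path \<nu> * kp_ghost \<nu> :: ('v, 'e) kp_symbol list \<Rightarrow>\<^sub>0 'f)"
proof -
  have \<mu>: "\<mu> \<in> paths \<Lambda>" and \<nu>: "\<nu> \<in> paths \<Lambda>" and src: "src \<Lambda> \<mu> = src \<Lambda> \<nu>"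
    using cycle by (auto simp: generalized_cycle_def)
  \<comment> \<open>This degree extends \<mu> to d(\<mu>) \<squnion> d(\<nu>). Then \<mu>\<tau> is
    at least as long as \<nu> in every coordinate, so a common extension of both forces \<nu> to be
    an initial segment of \<mu>\<tau>.\<close>
  let ?n = "sup (deg \<Lambda> \<mu>) (deg \<Lambda> \<nu>) - deg \<Lambda> \<mu>"
  have ext: "prefix \<nu> (compose \<Lambda> \<mu> \<tau>)" if "\<tau> \<in> paths_from \<Lambda> (src \<Lambda> \<mu>) ?n" for \<tau>
  proof -
    have \<tau>: "\<tau> \<in> paths \<Lambda>" "rng \<Lambda> \<tau> = src \<Lambda> \<mu>" "deg \<Lambda> \<tau> = ?n"
      using that by (auto simp: paths_from_def)
    obtain \<kappa> where \<kappa>: "prefix (compose \<Lambda> \<mu> \<tau>) \<kappa>" "prefix \<nu> \<kappa>"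
      using generalized_cycle_MCE[OF cycle \<tau>(1,2)] by blast
    have "deg \<Lambda> (compose \<Lambda> \<mu> \<tau>) = sup (deg \<Lambda> \<mu>) (deg \<Lambda> \<nu>)"
      using deg_compose[OF \<mu> \<tau>(1)] \<tau>(2,3) degree_diff_add[OF sup_ge1] by metis
    then have "deg \<Lambda> \<nu> \<le> deg \<Lambda> (compose \<Lambda> \<mu> \<tau>)"
      by (simp only: sup_ge2)
    then show ?thesis
      by (rule prefix_of_prefix[OF \<kappa>(2,1)])
  qed
  let ?f = "kp_path \<nu> * kp_ghost \<nu> :: ('v, 'e) kp_symbol list \<Rightarrow>\<^sub>0 'f"
  let ?x = "kp_path \<mu> * kp_ghost \<nu> :: ('v, 'e) kp_symbol list \<Rightarrow>\<^sub>0 'f"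
  let ?y = "kp_path \<nu> * kp_ghost \<mu> :: ('v, 'e) kp_symbol list \<Rightarrow>\<^sub>0 'f"
  note path = kp_path_closed[OF \<mu>] kp_path_closed[OF \<nu>]
    and ghost = kp_ghost_closed[OF \<mu>] kp_ghost_closed[OF \<nu>]
  have f: "?f \<in> carrier kp_free" and x: "?x \<in> carrier kp_free" and y: "?y \<in> carrier kp_free"
    using path ghost by (auto intro: kp_free_mult)
  \<comment> \<open>Paths with a common source multiply like matrix units. This alone yields four of
    the six corner equations.\<close>
  have cancel: "(kp_path \<alpha> * kp_ghost \<beta>) * (kp_path \<beta> * kp_ghost \<gamma>) \<approx>
      (kp_path \<alpha> * kp_ghost \<gamma> :: ('v, 'e) kp_symbol list \<Rightarrow>\<^sub>0 'f)"
    if "\<alpha> \<in> paths \<Lambda>" "\<beta> \<in> paths \<Lambda>" "\<gamma> \<in> paths \<Lambda>" "src \<Lambda> \<alpha> = src \<Lambda> \<beta>" for \<alpha> \<beta> \<gamma>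
  proof -
    have "kp_path \<alpha> * (kp_ghost \<beta> * kp_path \<beta>) \<approx>
        (kp_path \<alpha> * kp_p (src \<Lambda> \<alpha>) :: ('v, 'e) kp_symbol list \<Rightarrow>\<^sub>0 'f)"
      using kp_cong_mult_left[OF kp_path_closed[OF that(1)] kp_ghost_path[OF that(2)]] that(4) by simp
    also have "\<dots> \<approx> kp_path \<alpha>"
      using that(1) by (rule kp_vertex_path)
    finally show ?thesis
      using kp_cong_mult_right[OF kp_ghost_closed[OF that(3)], of "kp_path \<alpha> * (kp_ghost \<beta> * kp_path \<beta>)"]
      by (simp only: mult.assoc)
  qed
  \<comment> \<open>Together with \<open>yf\<close> this expresses that e lies below f; the cycle
    condition enters here, through \<open>ext\<close>.\<close>
  have fx: "?f * ?x \<approx> ?x"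
    using kp_cong_mult_right[OF ghost(2) kp_range_absorb(1)[OF \<mu> \<nu> ext]] by (simp only: mult.assoc)
  have yf: "?y * ?f \<approx> ?y"
    using kp_cong_mult_left[OF path(2) kp_range_absorb(2)[OF \<mu> \<nu> ext]] by (simp only: mult.assoc)
  have mult: "kp_class p \<otimes>\<^bsub>kp_algebra \<Lambda>\<^esub> kp_class q = kp_class r"
    if "p \<in> carrier kp_free" "q \<in> carrier kp_free" "p * q \<approx> r" for p q r
    using that by (simp only: kp_class_mult kp_class_eq_iff)
  have "kp_class ?x \<otimes>\<^bsub>kp_algebra \<Lambda>\<^esub> kp_class ?y = kp_class ?f"
    by (rule corner_finiteD[OF fin kp_class_closed[OF f] kp_class_closed[OF x] kp_class_closed[OF y]
      mult[OF f f cancel[OF \<nu> \<nu> \<nu> HOL.refl]] mult[OF f x fx] mult[OF x f cancel[OF \<mu> \<nu> \<nu> src]]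
      mult[OF f y cancel[OF \<nu> \<nu> \<mu> HOL.refl]] mult[OF y f yf] mult[OF y x cancel[OF \<nu> \<mu> \<nu> src[symmetric]]]])
  then have "?x * ?y \<approx> ?f"
    unfolding kp_class_mult[OF x y] kp_class_eq_iff .
  moreover have "kp_path \<mu> * kp_ghost \<mu> \<approx> ?x * ?y"
    using cancel[OF \<mu> \<nu> \<mu> src] by (rule kp_cong_sym)
  ultimately show ?thesis
    using kp_cong_trans by blast
qed

lemma poly_op_range:
  assumes "\<alpha> \<in> paths \<Lambda>"
  shows "poly_op (kp_path \<alpha> * kp_ghost \<alpha>) f x = (if x \<in> infinite_paths \<and> \<alpha> \<in> x then f x else 0)"
  using assms
proof (cases rule: trivial_path_cases)
  case (trivial v)
  then show ?thesis
    by (simp add: poly_op_mult poly_op_single symbol_op_def)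
next
  case nontrivial
  then show ?thesis
    by (simp add: kp_path_def kp_ghost_def poly_op_mult poly_op_single symbol_op_path_ghost[OF assms])
qed

lemma kp_range_eq_infinite_path:
  fixes \<mu> \<nu> :: 'e
  assumes "row_finite_no_sources \<Lambda>" and "\<mu> \<in> paths \<Lambda>" "\<nu> \<in> paths \<Lambda>"
    and "kp_path \<mu> * kp_ghost \<mu> \<approx> (kp_path \<nu> * kp_ghost \<nu> :: ('v, 'e) kp_symbol list \<Rightarrow>\<^sub>0 'f::field)"
    and "x \<in> infinite_paths"
  shows "\<mu> \<in> x \<longleftrightarrow> \<nu> \<in> x"
proof -
  \<comment> \<open>On the constant function 1 the two sides become the indicator functions of the
    cylinder sets, and 1 differs from 0 in the field.\<close>
  have "poly_op (kp_path \<mu> * kp_ghost \<mu> - kp_path \<nu> * kp_ghost \<nu>) (\<lambda>_. 1 :: 'f) x = 0"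
    using assms by (intro poly_op_ideal) (simp_all add: kp_cong_def kp_ideal_def)
  then show ?thesis
    using assms by (simp add: poly_op_diff poly_op_range split: if_splits)
qed

end

section \<open>The talented monoid\<close>

lemma image_mset_mset_set:
  "finite A \<Longrightarrow> image_mset f (mset_set A) = (\<Sum>a\<in>A. {#f a#})"
  by (induction A rule: finite_induct) simp_all

lemma talented_shift_inverse:
  fixes q :: "'k \<Rightarrow> int"
  shows "image_mset (\<lambda>(v, n). (v, n + q)) (image_mset (\<lambda>(v, n). (v, n + - q)) x) = x"
  by (simp add: multiset.map_comp comp_def case_prod_unfold add.assoc)

context k_graph
begin

lemma talented_cong_closed:
  "(x, y) \<in> talented_cong \<Lambda> \<Longrightarrow> x \<in> talented_free \<Lambda> \<and> y \<in> talented_free \<Lambda>"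
proof (induction rule: talented_cong.induct)
  case (relation v n i)
  then show ?case
    using src_closed by (cases "finite (paths_from \<Lambda> v (basis_vec i))") (auto simp: talented_free_def paths_from_def)
qed (auto simp: talented_free_def)

lemma talented_cong_add:
  assumes "(x, y) \<in> talented_cong \<Lambda>" "(x', y') \<in> talented_cong \<Lambda>"
  shows "(x + x', y + y') \<in> talented_cong \<Lambda>"
proof (rule talented_cong.trans)
  show "(x + x', y + x') \<in> talented_cong \<Lambda>"
    using assms talented_cong_closed by (blast intro: talented_cong.add)
  have "(x' + y, y' + y) \<in> talented_cong \<Lambda>"
    using assms talented_cong_closed by (blast intro: talented_cong.add)
  then show "(y + x', y + y') \<in> talented_cong \<Lambda>"
    by (simp add: add.commute)
qed

lemma talented_cong_sum:
  assumes "finite A" "\<And>a. a \<in> A \<Longrightarrow> (f a, g a) \<in> talented_cong \<Lambda>"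
  shows "(\<Sum>a\<in>A. f a, \<Sum>a\<in>A. g a) \<in> talented_cong \<Lambda>"
  using assms
proof (induction A rule: finite_induct)
  case empty
  show ?case by (simp add: talented_cong.refl talented_free_def)
next
  case (insert a A)
  then show ?case by (simp add: talented_cong_add)
qed

lemma talented_cong_shift:
  assumes "(x, y) \<in> talented_cong \<Lambda>"
  shows "(image_mset (\<lambda>(v, n). (v, n + q)) x, image_mset (\<lambda>(v, n). (v, n + q)) y) \<in> talented_cong \<Lambda>"
  using assms
proof (induction rule: talented_cong.induct)
  case (relation v n i)
  let ?g = "\<lambda>(v, n). (v, n + q)"
  have "image_mset ?g {#(v, n)#} = {#(v, n + q)#}"
    by simp
  moreover have "image_mset ?g (image_mset (\<lambda>\<alpha>. (src \<Lambda> \<alpha>, n + basis_vec i)) M)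
      = image_mset (\<lambda>\<alpha>. (src \<Lambda> \<alpha>, n + q + basis_vec i)) M" for M
    by (simp add: multiset.map_comp comp_def add_ac)
  ultimately show ?case
    using talented_cong.relation[OF relation, of "n + q" i] by (simp only:)
next
  case (refl x)
  then show ?case
    by (intro talented_cong.refl) (auto simp: talented_free_def)
next
  case (add x y z)
  then have "image_mset (\<lambda>(v, n). (v, n + q)) z \<in> talented_free \<Lambda>"
    by (auto simp: talented_free_def)
  with add.IH show ?case
    unfolding image_mset_union by (rule talented_cong.add)
qed (blast intro: talented_cong.sym talented_cong.trans)+

text \<open>The right-hand side of a defining relation is nonempty: there are no sources, and the
  set of paths is finite (\<open>mset_set\<close> of an infinite set would be empty). So the class
  of zero is a singleton and every v(m) is nonzero.\<close>

lemma talented_cong_empty: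
  assumes "row_finite_no_sources \<Lambda>" "(x, y) \<in> talented_cong \<Lambda>"
  shows "x = {#} \<longleftrightarrow> y = {#}"
  using assms(2)
proof (induction rule: talented_cong.induct)
  case (relation v n i)
  then show ?case
    using assms(1) by (auto simp: row_finite_no_sources_def mset_set_empty_iff)
qed auto

lemma talented_class_eq: "(x, y) \<in> talented_cong \<Lambda> \<Longrightarrow> talented_cong \<Lambda> `` {x} = talented_cong \<Lambda> `` {y}"
  by (blast intro: talented_cong.sym talented_cong.trans)

text \<open>The action is an image of sets of multisets, so that image has to be recognized as a
  full class; shifting back by \<open>- q\<close> provides the preimages.\<close>

lemma talented_shift_class:
  "talented_shift q (talented_cong \<Lambda> `` {x}) = talented_cong \<Lambda> `` {image_mset (\<lambda>(v, n). (v, n + q)) x}"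
proof
  show "talented_shift q (talented_cong \<Lambda> `` {x}) \<subseteq> talented_cong \<Lambda> `` {image_mset (\<lambda>(v, n). (v, n + q)) x}"
    by (auto simp: talented_shift_def intro: talented_cong_shift)
  show "talented_cong \<Lambda> `` {image_mset (\<lambda>(v, n). (v, n + q)) x} \<subseteq> talented_shift q (talented_cong \<Lambda> `` {x})"
  proof
    fix y assume "y \<in> talented_cong \<Lambda> `` {image_mset (\<lambda>(v, n). (v, n + q)) x}"
    then have "(image_mset (\<lambda>(v, n). (v, n + q)) x, y) \<in> talented_cong \<Lambda>"
      by blast
    \<comment> \<open>The shift by \<open>q\<close> is written with \<open>- (- q)\<close> so that
      \<open>talented_shift_inverse\<close> applies with \<open>- q\<close> for
      \<open>q\<close>.\<close>
    then have "(image_mset (\<lambda>(v, n). (v, n + - q)) (image_mset (\<lambda>(v, n). (v, n + - (- q))) x),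
        image_mset (\<lambda>(v, n). (v, n + - q)) y) \<in> talented_cong \<Lambda>"
      unfolding minus_minus by (rule talented_cong_shift)
    then have "image_mset (\<lambda>(v, n). (v, n + - q)) y \<in> talented_cong \<Lambda> `` {x}"
      unfolding talented_shift_inverse by blast
    then show "y \<in> talented_shift q (talented_cong \<Lambda> `` {x})"
      unfolding talented_shift_def
      by (rule image_eqI[where x = "image_mset (\<lambda>(v, n). (v, n + - q)) y", rotated])
        (simp only: talented_shift_inverse)
  qed
qed

section \<open>Expansion of a vertex along all paths of a given degree\<close>

lemma bij_betw_compose_paths:
  "bij_betw (\<lambda>(\<alpha>, \<beta>). compose \<Lambda> \<alpha> \<beta>)
     (SIGMA \<alpha>:paths_from \<Lambda> v n. paths_from \<Lambda> (src \<Lambda> \<alpha>) m) (paths_from \<Lambda> v (n + m))"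
  unfolding bij_betw_def
proof
  show "inj_on (\<lambda>(\<alpha>, \<beta>). compose \<Lambda> \<alpha> \<beta>) (SIGMA \<alpha>:paths_from \<Lambda> v n. paths_from \<Lambda> (src \<Lambda> \<alpha>) m)"
    by (rule inj_onI) (auto simp: paths_from_def dest: factor_unique)
  have "\<exists>p\<in>SIGMA \<alpha>:paths_from \<Lambda> v n. paths_from \<Lambda> (src \<Lambda> \<alpha>) m. \<gamma> = (\<lambda>(\<alpha>, \<beta>). compose \<Lambda> \<alpha> \<beta>) p"
    if "\<gamma> \<in> paths_from \<Lambda> v (n + m)" for \<gamma>
  proof -
    have "\<gamma> \<in> paths \<Lambda>" "deg \<Lambda> \<gamma> = n + m" "rng \<Lambda> \<gamma> = v"
      using that by (auto simp: paths_from_def)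
    then obtain \<alpha> \<beta> where "\<alpha> \<in> paths \<Lambda>" "\<beta> \<in> paths \<Lambda>" "deg \<Lambda> \<alpha> = n" "deg \<Lambda> \<beta> = m"
      "src \<Lambda> \<alpha> = rng \<Lambda> \<beta>" "\<gamma> = compose \<Lambda> \<alpha> \<beta>"
      using factor_exists by blast
    with \<open>rng \<Lambda> \<gamma> = v\<close> show ?thesis
      by (intro bexI[of _ "(\<alpha>, \<beta>)"]) (auto simp: paths_from_def rng_compose)
  qed
  then show "(\<lambda>(\<alpha>, \<beta>). compose \<Lambda> \<alpha> \<beta>) ` (SIGMA \<alpha>:paths_from \<Lambda> v n. paths_from \<Lambda> (src \<Lambda> \<alpha>) m)
      = paths_from \<Lambda> v (n + m)"
    by (auto simp: paths_from_def compose_closed rng_compose deg_compose)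
qed

text \<open>The defining relations treat unit vectors only, so the induction is on the total degree:
  one further relation is applied at each endpoint, and unique factorization turns the double sum
  into a sum over the longer paths.\<close>

lemma talented_cong_expand:
  assumes rf: "row_finite_no_sources \<Lambda>" and v: "v \<in> verts \<Lambda>"
  shows "({#(v, m)#}, \<Sum>\<alpha>\<in>paths_from \<Lambda> v n. {#(src \<Lambda> \<alpha>, m + (\<lambda>i. int (n i)))#}) \<in> talented_cong \<Lambda>"
proof (induction "\<Sum>i\<in>UNIV. n i" arbitrary: n)
  case 0
  then have "n = 0"
    by (simp add: fun_eq_iff)
  then have "paths_from \<Lambda> v n = {ident \<Lambda> v}" "m + (\<lambda>i. int (n i)) = m"
    using v by (simp_all only: paths_from_zero) (simp add: fun_eq_iff)
  moreover have "({#(v, m)#}, {#(v, m)#}) \<in> talented_cong \<Lambda>"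
    using v by (intro talented_cong.refl) (simp add: talented_free_def)
  ultimately show ?case
    using v by (simp add: src_ident)
next
  case (Suc k)
  then obtain i where i: "n i \<noteq> 0"
    by (metis sum.neutral nat.distinct(1))
  \<comment> \<open>Any coordinate that is not yet 0 may serve as the last step.\<close>
  define n' where "n' = n(i := n i - 1)"
  have n: "n = n' + basis_vec i"
    using i by (auto simp: n'_def basis_vec_def fun_eq_iff)
  have "(\<Sum>j\<in>UNIV. basis_vec i j) = (1 :: nat)"
    by (simp add: basis_vec_def)
  then have "k = (\<Sum>j\<in>UNIV. n' j)"
    using Suc.hyps(2) by (simp add: n sum.distrib)
  then have IH: "({#(v, m)#}, \<Sum>\<alpha>\<in>paths_from \<Lambda> v n'. {#(src \<Lambda> \<alpha>, m + (\<lambda>i. int (n' i)))#}) \<in> talented_cong \<Lambda>"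
    by (rule Suc.hyps(1))
  have fin: "finite (paths_from \<Lambda> u l)" if "u \<in> verts \<Lambda>" for u l
    using rf that by (simp add: row_finite_no_sources_def)
  have src: "src \<Lambda> \<alpha> \<in> verts \<Lambda>" if "\<alpha> \<in> paths_from \<Lambda> v n'" for \<alpha>
    using that src_closed by (auto simp: paths_from_def)
  have deg: "m + (\<lambda>j. int (n' j)) + basis_vec i = m + (\<lambda>j. int (n j))"
    by (auto simp: n basis_vec_def fun_eq_iff)
  have "(\<Sum>\<alpha>\<in>paths_from \<Lambda> v n'. {#(src \<Lambda> \<alpha>, m + (\<lambda>i. int (n' i)))#},
      \<Sum>\<alpha>\<in>paths_from \<Lambda> v n'. \<Sum>\<beta>\<in>paths_from \<Lambda> (src \<Lambda> \<alpha>) (basis_vec i). {#(src \<Lambda> \<beta>, m + (\<lambda>i. int (n i)))#})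
      \<in> talented_cong \<Lambda>"
  proof (rule talented_cong_sum[OF fin[OF v]])
    fix \<alpha> assume "\<alpha> \<in> paths_from \<Lambda> v n'"
    then show "({#(src \<Lambda> \<alpha>, m + (\<lambda>i. int (n' i)))#},
        \<Sum>\<beta>\<in>paths_from \<Lambda> (src \<Lambda> \<alpha>) (basis_vec i). {#(src \<Lambda> \<beta>, m + (\<lambda>i. int (n i)))#}) \<in> talented_cong \<Lambda>"
      using talented_cong.relation[OF src, of \<alpha> "m + (\<lambda>i. int (n' i))" i]
      by (simp add: image_mset_mset_set fin src deg)
  qed
  also have "(\<Sum>\<alpha>\<in>paths_from \<Lambda> v n'. \<Sum>\<beta>\<in>paths_from \<Lambda> (src \<Lambda> \<alpha>) (basis_vec i). {#(src \<Lambda> \<beta>, m + (\<lambda>i. int (n i)))#})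
      = (\<Sum>(\<alpha>, \<beta>)\<in>(SIGMA \<alpha>:paths_from \<Lambda> v n'. paths_from \<Lambda> (src \<Lambda> \<alpha>) (basis_vec i)).
          {#(src \<Lambda> \<beta>, m + (\<lambda>i. int (n i)))#})"
    using fin v src by (intro sum.Sigma) auto
  also have "\<dots> = (\<Sum>p\<in>(SIGMA \<alpha>:paths_from \<Lambda> v n'. paths_from \<Lambda> (src \<Lambda> \<alpha>) (basis_vec i)).
      {#(src \<Lambda> (case p of (\<alpha>, \<beta>) \<Rightarrow> compose \<Lambda> \<alpha> \<beta>), m + (\<lambda>i. int (n i)))#})"
    by (intro sum.cong) (auto simp: paths_from_def src_compose)
  also have "\<dots> = (\<Sum>\<gamma>\<in>paths_from \<Lambda> v n. {#(src \<Lambda> \<gamma>, m + (\<lambda>i. int (n i)))#})"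
    by (subst n, rule sum.reindex_bij_betw[OF bij_betw_compose_paths])
  finally show ?case
    by (rule talented_cong.trans[OF IH])
qed

text \<open>Starting at the exponent d(\<mu>) makes all endpoints carry the exponent
  \<open>N\<close>. The sum then depends on \<mu> only through its set of extensions of degree
  \<open>N\<close>, so two paths with the same extensions yield congruent symbols.\<close>

lemma talented_cong_extensions:
  assumes rf: "row_finite_no_sources \<Lambda>" and \<mu>: "\<mu> \<in> paths \<Lambda>" and N: "deg \<Lambda> \<mu> \<le> N"
  shows "({#(src \<Lambda> \<mu>, \<lambda>i. int (deg \<Lambda> \<mu> i))#},
    \<Sum>\<gamma> | prefix \<mu> \<gamma> \<and> deg \<Lambda> \<gamma> = N. {#(src \<Lambda> \<gamma>, \<lambda>i. int (N i))#}) \<in> talented_cong \<Lambda>"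
proof -
  let ?n = "N - deg \<Lambda> \<mu>"
  have deg: "(\<lambda>i. int (deg \<Lambda> \<mu> i)) + (\<lambda>i. int (?n i)) = (\<lambda>i. int (N i))"
    using N by (auto simp: fun_eq_iff le_fun_def of_nat_diff)
  have "bij_betw (compose \<Lambda> \<mu>) (paths_from \<Lambda> (src \<Lambda> \<mu>) ?n) {\<gamma>. prefix \<mu> \<gamma> \<and> deg \<Lambda> \<gamma> = N}"
    unfolding bij_betw_def
  proof
    show "inj_on (compose \<Lambda> \<mu>) (paths_from \<Lambda> (src \<Lambda> \<mu>) ?n)"
    proof (rule inj_onI)
      fix \<sigma> \<tau>
      assume "\<sigma> \<in> paths_from \<Lambda> (src \<Lambda> \<mu>) ?n" "\<tau> \<in> paths_from \<Lambda> (src \<Lambda> \<mu>) ?n"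
        and "compose \<Lambda> \<mu> \<sigma> = compose \<Lambda> \<mu> \<tau>"
      then show "\<sigma> = \<tau>"
        by - (rule factor_unique(2)[OF \<mu> _ _ \<mu> _ _ _ HOL.refl], simp_all add: paths_from_def)
    qed
    have "\<gamma> \<in> compose \<Lambda> \<mu> ` paths_from \<Lambda> (src \<Lambda> \<mu>) ?n" if \<gamma>: "prefix \<mu> \<gamma>" "deg \<Lambda> \<gamma> = N" for \<gamma>
    proof -
      obtain \<tau> where \<tau>: "\<tau> \<in> paths \<Lambda>" "src \<Lambda> \<mu> = rng \<Lambda> \<tau>" "\<gamma> = compose \<Lambda> \<mu> \<tau>"
        using \<gamma>(1) by (rule prefixE)
      then have "deg \<Lambda> \<mu> + deg \<Lambda> \<tau> = deg \<Lambda> \<mu> + ?n"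
        using \<mu> \<gamma>(2) N by (simp add: deg_compose degree_diff_add)
      then show ?thesis
        using \<tau> by (auto simp: paths_from_def degree_add_left_cancel)
    qed
    then show "compose \<Lambda> \<mu> ` paths_from \<Lambda> (src \<Lambda> \<mu>) ?n = {\<gamma>. prefix \<mu> \<gamma> \<and> deg \<Lambda> \<gamma> = N}"
      using \<mu> N by (auto simp: paths_from_def prefix_compose deg_compose degree_diff_add)
  qed
  then have "(\<Sum>\<tau>\<in>paths_from \<Lambda> (src \<Lambda> \<mu>) ?n. {#(src \<Lambda> (compose \<Lambda> \<mu> \<tau>), \<lambda>i. int (N i))#})
      = (\<Sum>\<gamma> | prefix \<mu> \<gamma> \<and> deg \<Lambda> \<gamma> = N. {#(src \<Lambda> \<gamma>, \<lambda>i. int (N i))#})"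
    by (rule sum.reindex_bij_betw)
  moreover have "(\<Sum>\<tau>\<in>paths_from \<Lambda> (src \<Lambda> \<mu>) ?n. {#(src \<Lambda> (compose \<Lambda> \<mu> \<tau>), \<lambda>i. int (N i))#})
      = (\<Sum>\<tau>\<in>paths_from \<Lambda> (src \<Lambda> \<mu>) ?n. {#(src \<Lambda> \<tau>, \<lambda>i. int (N i))#})"
    using \<mu> by (intro sum.cong) (auto simp: paths_from_def src_compose)
  ultimately show ?thesis
    using talented_cong_expand[OF rf src_closed[OF \<mu>], of "\<lambda>i. int (deg \<Lambda> \<mu> i)" ?n] by (simp only: deg)
qed

text \<open>The shift by \<open>n - m\<close> takes v(m) to v(n) and so fixes their common class,
  which is nonzero by \<open>talented_cong_empty\<close>.\<close>

lemma talented_action_free_cong_vertex: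
  assumes "talented_action_free \<Lambda>" "row_finite_no_sources \<Lambda>" "v \<in> verts \<Lambda>"
    and cong: "({#(v, m)#}, {#(v, n)#}) \<in> talented_cong \<Lambda>"
  shows "m = n"
proof (rule ccontr)
  assume "m \<noteq> n"
  then obtain i where "m i \<noteq> n i"
    by (auto simp: fun_eq_iff)
  then have "(n - m) i \<noteq> 0 i"
    by simp
  then have "n - m \<noteq> 0"
    by metis
  define a where "a = talented_cong \<Lambda> `` {{#(v, m)#}}"
  have free: "{#(v, m)#} \<in> talented_free \<Lambda>"
    using assms(3) by (simp add: talented_free_def)
  have "a \<in> carrier (talented_monoid \<Lambda>)"
    using free by (simp add: a_def talented_monoid_def quotientI)
  moreover have "a \<noteq> \<one>\<^bsub>talented_monoid \<Lambda>\<^esub>"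
    using talented_cong.refl[OF free] talented_cong_empty[OF assms(2), of "{#}" "{#(v, m)#}"]
    by (auto simp: a_def talented_monoid_def)
  moreover have "talented_shift (n - m) a = a"
  proof -
    have "m + (n - m) = n"
      by (simp add: fun_eq_iff)
    then show ?thesis
      unfolding a_def talented_shift_class using talented_class_eq[OF cong] by simp
  qed
  ultimately show False
    using assms(1) \<open>n - m \<noteq> 0\<close> by (auto simp: talented_action_free_def)
qed

end

theorem proposition4p2p7:
  fixes \<Lambda> :: "('v, 'e, 'k::finite) kgraph"
  assumes "k_graph \<Lambda>"
    and "row_finite_no_sources \<Lambda>"
    and "generalized_cycle \<Lambda> \<mu> \<nu>"
    and "talented_action_free \<Lambda>"
  shows "\<not> ultramatricial
    (kp_algebra \<Lambda> :: ('f::field, (('v, 'e) kp_symbol list \<Rightarrow>\<^sub>0 'f) set) module)"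
proof
  interpret k_graph \<Lambda>
    by (rule assms(1))
  have \<mu>: "\<mu> \<in> paths \<Lambda>" and \<nu>: "\<nu> \<in> paths \<Lambda>" and "\<mu> \<noteq> \<nu>" and src: "src \<Lambda> \<mu> = src \<Lambda> \<nu>"
    using assms(3) by (auto simp: generalized_cycle_def)
  assume "ultramatricial (kp_algebra \<Lambda> :: ('f, (('v, 'e) kp_symbol list \<Rightarrow>\<^sub>0 'f) set) module)"
  then have mem: "\<mu> \<in> x \<longleftrightarrow> \<nu> \<in> x" if "x \<in> infinite_paths" for x
    using kp_range_eq_infinite_path[OF assms(2) \<mu> \<nu> kp_range_eq[OF assms(3) corner_finite_ultramatricial] that]
    by blast
  define N where "N = sup (deg \<Lambda> \<mu>) (deg \<Lambda> \<nu>)"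
  have N: "deg \<Lambda> \<mu> \<le> N" "deg \<Lambda> \<nu> \<le> N"
    by (simp_all add: N_def)
  have "prefix \<mu> \<gamma> \<longleftrightarrow> prefix \<nu> \<gamma>" if \<gamma>: "\<gamma> \<in> paths \<Lambda>" "deg \<Lambda> \<gamma> = N" for \<gamma>
  proof -
    obtain x where x: "x \<in> infinite_paths" "\<gamma> \<in> x"
      by (rule infinite_path_through[OF assms(2) \<gamma>(1)])
    \<comment> \<open>Up to the degree of \<gamma>, membership in the infinite path through \<gamma>
      is the same as being an initial segment of \<gamma>; this turns \<open>mem\<close> into a
      statement about finite paths.\<close>
    have "prefix \<alpha> \<gamma> \<longleftrightarrow> \<alpha> \<in> x" if "deg \<Lambda> \<alpha> \<le> deg \<Lambda> \<gamma>" for \<alpha>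
      using x that infinite_path_prefix infinite_pathD(2) by blast
    then show ?thesis
      using mem[OF x(1)] N \<gamma>(2) by simp
  qed
  then have "{\<gamma>. prefix \<mu> \<gamma> \<and> deg \<Lambda> \<gamma> = N} = {\<gamma>. prefix \<nu> \<gamma> \<and> deg \<Lambda> \<gamma> = N}"
    using prefix_closed(2) by blast
  \<comment> \<open>Both symbols expand to the same sum over extensions of degree \<open>N\<close>,
    and s(\<mu>) = s(\<nu>) makes them symbols of one vertex.\<close>
  then have "({#(src \<Lambda> \<mu>, \<lambda>i. int (deg \<Lambda> \<mu> i))#}, {#(src \<Lambda> \<mu>, \<lambda>i. int (deg \<Lambda> \<nu> i))#}) \<in> talented_cong \<Lambda>"
    using talented_cong_extensions[OF assms(2) \<mu> N(1)]
      talented_cong.sym[OF talented_cong_extensions[OF assms(2) \<nu> N(2)]]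
    by (simp only: src) (rule talented_cong.trans)
  then have "(\<lambda>i. int (deg \<Lambda> \<mu> i)) = (\<lambda>i. int (deg \<Lambda> \<nu> i))"
    by (rule talented_action_free_cong_vertex[OF assms(4,2) src_closed[OF \<mu>]])
  then have deg: "deg \<Lambda> \<mu> = deg \<Lambda> \<nu>"
    by (simp add: fun_eq_iff)
  \<comment> \<open>An infinite path through \<mu> also passes through \<nu>, and it has only one
    initial segment of their common degree.\<close>
  obtain x where x: "x \<in> infinite_paths" "\<mu> \<in> x"
    by (rule infinite_path_through[OF assms(2) \<mu>])
  then have "\<nu> \<in> x"
    using mem by simp
  then have "\<mu> = \<nu>"
    using infinite_pathD(3)[OF x] deg by simp
  with \<open>\<mu> \<noteq> \<nu>\<close> show False ..
qed

end
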